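(* Let $q>0$, $q\neq 1$, $M\in\mathbb N$, $\vec k=(k_1,\dots,k_M)$ with all $k_j>0$, and $\lambda\in\mathbb R$. For $\eta\in X_d$ and $\zeta\in\mathcal S_\lambda$ define $$P_{\mathsf L}(\eta,\zeta)=q^{-\frac12 u(\eta,\vec k)}\prod_{j=1}^M p_{\mathrm A}\big(\eta_j,\zeta_j;h^-_{j-1}(\zeta);k_j;q^{-1}\big).$$ Then $P_{\mathsf L}$ is a duality function between $\mathrm{ASIP}(q,\vec k)$ and $\mathrm{ASIP}_{\mathsf L}(q,\vec k,\lambda)$, i.e. for all $\eta\in X_d$ and $\zeta\in\mathcal S_\lambda$, $$\big[L^{\mathrm{ASIP}}_{q,\vec k}P_{\mathsf L}(\cdot,\zeta)\big](\eta)=\big[L^{\mathrm{ASIP}_{\mathsf L}}_{q,\vec k,\lambda}P_{\mathsf L}(\eta,\cdot)\big](\zeta).$$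
   Context: Notation: $X_d=\mathbb Z_{\ge 0}^M$; $|\eta|=\eta_1+\dots+\eta_M$; $[a]_q=\frac{q^a-q^{-a}}{q-q^{-1}}$; $(a;q)_n=\prod_{i=0}^{n-1}(1-aq^i)$. The $q$-hypergeometric series is ${}_{3}\varphi_2(a_1,a_2,a_3;b_1,b_2;q,z)=\sum_{n\ge0}\frac{(a_1;q)_n(a_2;q)_n(a_3;q)_n}{(b_1;q)_n(b_2;q)_n}\frac{z^n}{(q;q)_n}$, and if some upper parameter is $q^{-N}$ ($N\in\mathbb Z_{\ge0}$), it is a finite sum over $n\le N$. $\eta^{j,m}$ is the state obtained from $\eta$ by moving one particle from site $j$ to site $m$ if $\eta_j\ge1$, and $\eta^{j,m}=\eta$ otherwise. $\mathrm{ASIP}(q,\vec k)$ on $X_d$ has generator $$[L^{\mathrm{ASIP}}_{q,\vec k}f](\eta)=\sum_{j=1}^{M-1}c_j^+(\eta)[f(\eta^{j,j+1})-f(\eta)]+c_{j+1}^-(\eta)[f(\eta^{j+1,j})-f(\eta)],$$ $c_j^+=q^{\eta_j+k_j-\eta_{j+1}-1}[\eta_j]_q[\eta_{j+1}+k_{j+1}]_q$, $\;c_j^-=q^{-(\eta_j+k_j-\eta_{j-1}-1)}[\eta_j]_q[\eta_{j-1}+k_{j-1}]_q$. Height function: $h^-_0=\lambda$, $h^-_j(\zeta)=\lambda+\sum_{i=1}^j(2\zeta_i+k_i)$. State space: $\mathcal S_\lambda=X_d$ if $\lambda>-1$, and $\mathcal S_\lambda=\{\zeta\in X_d:2|\zeta|+|\vec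 k|+\lambda<0\}$ if $\lambda\le-1$. $\mathrm{ASIP}_{\mathsf L}(q,\vec k,\lambda)$ (left dynamic ASIP) on $\mathcal S_\lambda$ has generator $$[L^{\mathrm{ASIP}_{\mathsf L}}_{q,\vec k,\lambda}f](\zeta)=\sum_{j=1}^{M-1}C_j^{\mathsf L,+}(\zeta)[f(\zeta^{j,j+1})-f(\zeta)]+C_{j+1}^{\mathsf L,-}(\zeta)[f(\zeta^{j+1,j})-f(\zeta)],$$ $$C_j^{\mathsf L,+}=[\zeta_j]_q[\zeta_{j+1}+k_{j+1}]_q\frac{[h^-_{j-1}+\zeta_j]_q[h^-_j+\zeta_{j+1}]_q}{[h^-_j]_q[h^-_j-1]_q},\qquad C_j^{\mathsf L,-}=[\zeta_j]_q[\zeta_{j-1}+k_{j-1}]_q\frac{[h^-_{j-1}-\zeta_{j-1}]_q[h^-_j-\zeta_j]_q}{[h^-_{j-1}]_q[h^-_{j-1}+1]_q},$$ with $h^-_i=h^-_i(\zeta)$. Conventions: a rate is $0$ when the departing site is empty ($\zeta_j=0$), and $[h^-_{j-1}-\zeta_{j-1}]_q/[h^-_{j-1}]_q$ is read as $1$ when $\zeta_{j-1}=0$. $u(\eta,\vec k)=\sum_{j=1}^M\eta_j\big(k_j+2\sum_{i=1}^{j-1}k_i\big)$. Al-Salam–Chihara polynomials (renormalized): for $n,x\in\mathbb Z_{\ge0}$ and any base $q>0$, $q\ne1$, $$p_{\mathrm A}(n,x;\rho;k;q)=q^{-\frac12n(2\rho+k+1)}\,{}_3\varphi_2\big(q^{-2n},q^{-2x},q^{2x+2\rho+2k};\,q^{2k},0;\,q^2,q^2\big);$$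 in the claim it is used with $q$ replaced by $q^{-1}$ everywhere. *)

theory Defs
  imports Complex_Main
begin

section \<open>q-calculus\<close>

definition qnum :: "real \<Rightarrow> real \<Rightarrow> real" where
  "qnum q a = (q powr a - q powr (- a)) / (q - inverse q)"

definition qpoch :: "real \<Rightarrow> real \<Rightarrow> nat \<Rightarrow> real" where
  "qpoch a q n = (\<Prod>i<n. 1 - a * q ^ i)"

text \<open>
  If some upper parameter is \<open>q ^ (- N)\<close>, all terms with \<open>n > N\<close> vanish, so that the
  series below is a finite sum for every base \<open>q > 0\<close>, \<open>q \<noteq> 1\<close>.
\<close>
definition qhyp_3_2 ::
    "real \<Rightarrow> real \<Rightarrow> real \<Rightarrow> real \<Rightarrow> real \<Rightarrow> real \<Rightarrow> real \<Rightarrow> real" where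
  "qhyp_3_2 a1 a2 a3 b1 b2 q z =
     (\<Sum>n. (qpoch a1 q n * qpoch a2 q n * qpoch a3 q n) / (qpoch b1 q n * qpoch b2 q n)
            * (z ^ n / qpoch q q n))"

text \<open>Renormalized Al-Salam--Chihara polynomials.\<close>
definition p_A :: "nat \<Rightarrow> nat \<Rightarrow> real \<Rightarrow> real \<Rightarrow> real \<Rightarrow> real" where
  "p_A n x \<rho> k q =
     q powr (- (1/2) * real n * (2 * \<rho> + k + 1)) *
     qhyp_3_2 (q powr (- 2 * real n)) (q powr (- 2 * real x))
              (q powr (2 * real x + 2 * \<rho> + 2 * k))
              (q powr (2 * k)) 0 (q\<^sup>2) (q\<^sup>2)"

section \<open>States\<close>

text \<open>
  The sites are \<open>1, \<dots>, M\<close>. A state is a function on \<open>nat\<close> that vanishes off the sites;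
  the parameters \<open>k j\<close> are only used for \<open>j \<in> {1..M}\<close>.
\<close>
type_synonym state = "nat \<Rightarrow> nat"

definition X_d :: "nat \<Rightarrow> state set" where
  "X_d M = {\<eta>. \<forall>i. i \<notin> {1..M} \<longrightarrow> \<eta> i = 0}"

definition S_dyn :: "nat \<Rightarrow> (nat \<Rightarrow> real) \<Rightarrow> real \<Rightarrow> state set" where
  "S_dyn M k lam =
     (if lam > - 1 then X_d M
      else {\<zeta> \<in> X_d M. 2 * real (\<Sum>j=1..M. \<zeta> j) + (\<Sum>j=1..M. k j) + lam < 0})"

text \<open>Only used for neighbouring (in particular distinct) sites \<open>j\<close> and \<open>m\<close>.\<close>
definition hop :: "state \<Rightarrow> nat \<Rightarrow> nat \<Rightarrow> state" where
  "hop \<eta> j m = (if \<eta> j \<ge> 1 then \<eta>(j := \<eta> j - 1, m := \<eta> m + 1) else \<eta>)"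

section \<open>ASIP\<close>

definition c_plus :: "real \<Rightarrow> (nat \<Rightarrow> real) \<Rightarrow> nat \<Rightarrow> state \<Rightarrow> real" where
  "c_plus q k j \<eta> =
     q powr (real (\<eta> j) + k j - real (\<eta> (j + 1)) - 1) *
     qnum q (real (\<eta> j)) * qnum q (real (\<eta> (j + 1)) + k (j + 1))"

definition c_minus :: "real \<Rightarrow> (nat \<Rightarrow> real) \<Rightarrow> nat \<Rightarrow> state \<Rightarrow> real" where
  "c_minus q k j \<eta> =
     q powr (- (real (\<eta> j) + k j - real (\<eta> (j - 1)) - 1)) *
     qnum q (real (\<eta> j)) * qnum q (real (\<eta> (j - 1)) + k (j - 1))"

definition L_ASIP ::
    "nat \<Rightarrow> real \<Rightarrow> (nat \<Rightarrow> real) \<Rightarrow> (state \<Rightarrow> real) \<Rightarrow> state \<Rightarrow> real" where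
  "L_ASIP M q k f \<eta> =
     (\<Sum>j=1..<M. c_plus q k j \<eta> * (f (hop \<eta> j (j + 1)) - f \<eta>)
               + c_minus q k (j + 1) \<eta> * (f (hop \<eta> (j + 1) j) - f \<eta>))"

section \<open>Left dynamic ASIP\<close>

definition height :: "(nat \<Rightarrow> real) \<Rightarrow> real \<Rightarrow> state \<Rightarrow> nat \<Rightarrow> real" where
  "height k lam \<zeta> j = lam + (\<Sum>i=1..j. 2 * real (\<zeta> i) + k i)"

text \<open>
  For \<open>k > 0\<close> and states in \<open>S_dyn M k lam\<close> with \<open>\<zeta> j \<ge> 1\<close>, the only denominator below
  that can vanish is \<open>qnum q (height k lam \<zeta> (j - 1))\<close> in \<open>C_minus\<close>, and only when
  \<open>\<zeta> (j - 1) = 0\<close>. The quotient containing it is read as \<open>1\<close> in that case.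
\<close>
definition C_plus :: "real \<Rightarrow> (nat \<Rightarrow> real) \<Rightarrow> real \<Rightarrow> nat \<Rightarrow> state \<Rightarrow> real" where
  "C_plus q k lam j \<zeta> =
     (let h = height k lam \<zeta> in
      if \<zeta> j = 0 then 0
      else qnum q (real (\<zeta> j)) * qnum q (real (\<zeta> (j + 1)) + k (j + 1)) *
           ((qnum q (h (j - 1) + real (\<zeta> j)) * qnum q (h j + real (\<zeta> (j + 1)))) /
            (qnum q (h j) * qnum q (h j - 1))))"

definition C_minus :: "real \<Rightarrow> (nat \<Rightarrow> real) \<Rightarrow> real \<Rightarrow> nat \<Rightarrow> state \<Rightarrow> real" where
  "C_minus q k lam j \<zeta> =
     (let h = height k lam \<zeta> in
      if \<zeta> j = 0 then 0
      else qnum q (real (\<zeta> j)) * qnum q (real (\<zeta> (j - 1)) + k (j - 1)) *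
           (if \<zeta> (j - 1) = 0 then 1
            else qnum q (h (j - 1) - real (\<zeta> (j - 1))) / qnum q (h (j - 1))) *
           (qnum q (h j - real (\<zeta> j)) / qnum q (h (j - 1) + 1)))"

text \<open>
  Hops preserve the number of particles, so that for \<open>\<zeta> \<in> S_dyn M k lam\<close> only values
  of \<open>f\<close> on \<open>S_dyn M k lam\<close> occur with a nonzero rate.
\<close>
definition L_ASIP_L ::
    "nat \<Rightarrow> real \<Rightarrow> (nat \<Rightarrow> real) \<Rightarrow> real \<Rightarrow> (state \<Rightarrow> real) \<Rightarrow> state \<Rightarrow> real" where
  "L_ASIP_L M q k lam f \<zeta> =
     (\<Sum>j=1..<M. C_plus q k lam j \<zeta> * (f (hop \<zeta> j (j + 1)) - f \<zeta>)
               + C_minus q k lam (j + 1) \<zeta> * (f (hop \<zeta> (j + 1) j) - f \<zeta>))"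

section \<open>Duality\<close>

definition duality_function ::
    "'a set \<Rightarrow> (('a \<Rightarrow> real) \<Rightarrow> 'a \<Rightarrow> real) \<Rightarrow>
     'b set \<Rightarrow> (('b \<Rightarrow> real) \<Rightarrow> 'b \<Rightarrow> real) \<Rightarrow> ('a \<Rightarrow> 'b \<Rightarrow> real) \<Rightarrow> bool" where
  "duality_function X L Y L' D \<longleftrightarrow>
     (\<forall>\<eta>\<in>X. \<forall>\<zeta>\<in>Y. L (\<lambda>\<eta>'. D \<eta>' \<zeta>) \<eta> = L' (\<lambda>\<zeta>'. D \<eta> \<zeta>') \<zeta>)"

definition u_weight :: "nat \<Rightarrow> (nat \<Rightarrow> real) \<Rightarrow> state \<Rightarrow> real" where
  "u_weight M k \<eta> = (\<Sum>j=1..M. real (\<eta> j) * (k j + 2 * (\<Sum>i=1..<j. k i)))"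

definition P_L :: "nat \<Rightarrow> real \<Rightarrow> (nat \<Rightarrow> real) \<Rightarrow> real \<Rightarrow> state \<Rightarrow> state \<Rightarrow> real" where
  "P_L M q k lam \<eta> \<zeta> =
     q powr (- (1/2) * u_weight M k \<eta>) *
     (\<Prod>j=1..M. p_A (\<eta> j) (\<zeta> j) (height k lam \<zeta> (j - 1)) (k j) (inverse q))"

end

(*
  A hop across the bond (j, j+1), of either process, changes neither the height h_{j-1} nor h_{j+1},
  so the duality can be verified bond by bond, i.e. for two sites with boundary value h_{j-1}.

  There the function is, up to a factor depending only on the particle number, a product of two
  terminating 3phi2 series with arguments (Q^-n, a, b).  A dual hop multiplies a and b by Q or 1/Q.
  Contiguous relations express each shifted series through the series for n and n-1 (or n+1), with
  prefactors which are exactly the numerators of the dynamic rates.  Both sides of the duality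
  relation thereby become bilinear in the unshifted series at the two sites, and the coefficients
  agree as rational functions.
*)
theory Submission
  imports Defs
begin

section \<open>q-shifted factorials\<close>

text \<open>Why the prefactors fit the rates: let \<open>h = \<rho> + 2 * x1 + k1\<close> be the
  middle height. Up to nonzero factors, \<open>1 - a1\<close>, \<open>b1 - c1\<close>,
  \<open>a2 - c2\<close> and \<open>b2 - c2\<close> are the q-numbers of \<open>x1\<close>,
  \<open>\<rho> + x1\<close>, \<open>x2 + k2\<close> and \<open>h + x2\<close>, the four numerators
  of a right hop; \<open>1 - a2\<close>, \<open>a1 - c1\<close>, \<open>1 - b1\<close> and
  \<open>1 - b2\<close> play this role for a left hop. Any of them may vanish for special heights,
  so the contiguous relations stay in product form and the rates supply exactly the missing factors.
  What has to be nonzero are the denominators, the q-numbers of \<open>h\<close>,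
  \<open>h - 1\<close> and \<open>h + 1\<close>. The state space guarantees this only when the
  departing site is occupied, and for a left hop the q-number of \<open>h\<close> can still vanish
  if the first site is empty. Hence the separate treatment of empty sites. The two sites are coupled
  by \<open>b1 * c2 = a1 * a2 * b2\<close>. Since the relations at the second site are symmetric in
  \<open>a2\<close> and \<open>b2\<close>, they enter the final identity only through their
  sum.\<close>

lemma qpoch_0 [simp]: "qpoch a Q 0 = 1"
  by (simp add: qpoch_def)

lemma qpoch_Suc: "qpoch a Q (Suc n) = qpoch a Q n * (1 - a * Q ^ n)"
  by (simp add: qpoch_def)

lemma qpoch_zero_base [simp]: "qpoch 0 Q n = 1"
  by (simp add: qpoch_def)

text \<open>Both sides are the shifted factorial of length \<open>Suc n\<close> at \<open>a\<close>,
  with the first or the last factor split off.\<close>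

lemma qpoch_shift: "(1 - a) * qpoch (a * Q) Q n = (1 - a * Q ^ n) * qpoch a Q n"
proof (induction n)
  case (Suc n)
  have "(1 - a) * qpoch (a * Q) Q (Suc n)
      = ((1 - a) * qpoch (a * Q) Q n) * (1 - a * Q * Q ^ n)"
    by (simp add: qpoch_Suc mult_ac)
  also have "\<dots> = (1 - a * Q ^ n) * qpoch a Q n * (1 - a * Q * Q ^ n)"
    by (simp only: Suc.IH)
  finally show ?case by (simp add: qpoch_Suc mult_ac)
qed simp

lemma qpoch_neq_0:
  assumes "\<And>i. a * Q ^ i \<noteq> 1"
  shows "qpoch a Q n \<noteq> 0"
  using assms by (simp add: qpoch_def)

lemma qpoch_inverse_power_eq_0:
  assumes "Q \<noteq> 0" and "n < i"
  shows "qpoch (inverse (Q ^ n)) Q i = 0"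
  using assms by (auto simp: qpoch_def intro!: bexI[of _ n])

lemma power_Suc_neq_1:
  fixes Q :: real
  assumes "Q > 0" and "Q \<noteq> 1"
  shows "Q * Q ^ i \<noteq> 1"
proof
  assume "Q * Q ^ i = 1"
  then have "Q ^ Suc i = 1" by simp
  then show False using assms power_eq_1_iff[of Q "Suc i"] by auto
qed

section \<open>Contiguous relations\<close>

text \<open>In the application \<open>Q = q powr -2\<close>, \<open>c = Q powr k\<close>, \<open>a = Q powr - x\<close> and
  \<open>b = Q powr (x + \<rho> + k)\<close>, so that \<open>x \<mapsto> x - 1\<close> for fixed \<open>\<rho>\<close> is \<open>(a, b) \<mapsto> (a Q, b / Q)\<close>,
  and \<open>x \<mapsto> x + 1\<close> together with \<open>\<rho> \<mapsto> \<rho> - 2\<close> is \<open>(a, b) \<mapsto> (a / Q, b / Q)\<close>.\<close>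
definition asc_weight :: "real \<Rightarrow> real \<Rightarrow> real \<Rightarrow> real \<Rightarrow> nat \<Rightarrow> real" where
  "asc_weight Q c a b i = qpoch a Q i * qpoch b Q i / (qpoch c Q i * qpoch Q Q i) * Q ^ i"

definition asc :: "real \<Rightarrow> real \<Rightarrow> nat \<Rightarrow> real \<Rightarrow> real \<Rightarrow> real" where
  "asc Q c n a b = (\<Sum>i\<le>n. qpoch (inverse (Q ^ n)) Q i * asc_weight Q c a b i)"

lemma asc_eq_sum:
  assumes "Q \<noteq> 0" and "n \<le> m"
  shows "asc Q c n a b = (\<Sum>i\<le>m. qpoch (inverse (Q ^ n)) Q i * asc_weight Q c a b i)"
  unfolding asc_def
  by (rule sum.mono_neutral_left) (use assms qpoch_inverse_power_eq_0 in auto)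

lemma qhyp_3_2_eq_asc:
  assumes "Q \<noteq> 0"
  shows "qhyp_3_2 (inverse (Q ^ n)) a b c 0 Q Q = asc Q c n a b"
proof -
  have "qhyp_3_2 (inverse (Q ^ n)) a b c 0 Q Q
      = (\<Sum>i. qpoch (inverse (Q ^ n)) Q i * asc_weight Q c a b i)"
    unfolding qhyp_3_2_def asc_weight_def by (simp add: field_simps)
  also have "\<dots> = asc Q c n a b"
    unfolding asc_def
    by (rule suminf_finite) (use assms qpoch_inverse_power_eq_0 in auto)
  finally show ?thesis .
qed

lemma asc_commute: "asc Q c n a b = asc Q c n b a"
  by (simp add: asc_def asc_weight_def mult.commute)

lemma asc_1 [simp]: "asc Q c n 1 b = 1"
proof -
  have "qpoch 1 Q i = 0" if "i \<noteq> 0" for i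
    using that by (auto simp: qpoch_def intro!: bexI[of _ 0])
  then have "asc Q c n 1 b = (\<Sum>i\<le>n. if i = 0 then 1 else 0)"
    unfolding asc_def by (intro sum.cong) (auto simp: asc_weight_def)
  then show ?thesis by simp
qed

lemma asc_0 [simp]: "asc Q c 0 a b = 1"
  by (simp add: asc_def asc_weight_def)

lemma qpoch_inverse_power_Suc:
  assumes "Q \<noteq> 0"
  shows "qpoch (inverse (Q ^ Suc n)) Q (Suc i)
       = (1 - inverse (Q ^ Suc n)) * qpoch (inverse (Q ^ n)) Q i"
proof -
  have "qpoch (inverse (Q ^ Suc n)) Q (Suc i)
      = (1 - inverse (Q ^ Suc n)) * (\<Prod>j<i. 1 - inverse (Q ^ Suc n) * Q ^ Suc j)"
    unfolding qpoch_def by (subst prod.lessThan_Suc_shift) simp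
  then show ?thesis using assms by (simp add: qpoch_def field_simps)
qed

text \<open>This is what trades a power \<open>Q ^ i\<close> inside a sum for a change of degree.
  For \<open>n = 0\<close> both sides vanish, on the right because \<open>qpoch 1 Q i = 0\<close>
  unless \<open>i = 0\<close>.\<close>

lemma qpoch_inverse_power_pred:
  assumes "Q \<noteq> 0"
  shows "(Q ^ n - 1) * qpoch (inverse (Q ^ (n - 1))) Q i
       = (Q ^ n - Q ^ i) * qpoch (inverse (Q ^ n)) Q i"
proof (cases n)
  case 0
  have "qpoch 1 Q i = 0" if "i \<noteq> 0"
    using that by (auto simp: qpoch_def intro!: bexI[of _ 0])
  then show ?thesis using 0 by (cases "i = 0") auto
next
  case (Suc m)
  show ?thesis
    using qpoch_inverse_power_Suc[OF assms, of m i] assms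
    by (simp add: Suc qpoch_Suc field_simps)
qed

lemma asc_weight_Suc:
  assumes "Q > 0" "Q \<noteq> 1" and "\<And>i. c * Q ^ i \<noteq> 1"
  shows "(1 - c * Q ^ i) * (1 - Q * Q ^ i) * asc_weight Q c a b (Suc i)
       = Q * (1 - a * Q ^ i) * (1 - b * Q ^ i) * asc_weight Q c a b i"
proof -
  have "qpoch c Q i \<noteq> 0" "qpoch Q Q i \<noteq> 0" "1 - c * Q ^ i \<noteq> 0" "1 - Q * Q ^ i \<noteq> 0"
    using assms power_Suc_neq_1[of Q] qpoch_neq_0[of c Q] qpoch_neq_0[of Q Q] by auto
  then show ?thesis
    by (simp add: asc_weight_def qpoch_Suc divide_simps)
qed

lemma asc_insert_power:
  assumes "Q \<noteq> 0"
  shows "(\<Sum>i\<le>n. qpoch (inverse (Q ^ n)) Q i * asc_weight Q c a b i * Q ^ i)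
       = Q ^ n * asc Q c n a b - (Q ^ n - 1) * asc Q c (n - 1) a b"
proof -
  have "(Q ^ n - 1) * asc Q c (n - 1) a b
      = (\<Sum>i\<le>n. ((Q ^ n - 1) * qpoch (inverse (Q ^ (n - 1))) Q i) * asc_weight Q c a b i)"
    by (subst asc_eq_sum[of Q "n - 1" n]) (simp_all add: assms sum_distrib_left mult.assoc)
  also have "\<dots> = (\<Sum>i\<le>n. (Q ^ n - Q ^ i) * qpoch (inverse (Q ^ n)) Q i * asc_weight Q c a b i)"
    by (simp only: qpoch_inverse_power_pred[OF assms])
  also have "\<dots> = Q ^ n * asc Q c n a b
      - (\<Sum>i\<le>n. qpoch (inverse (Q ^ n)) Q i * asc_weight Q c a b i * Q ^ i)"
    by (simp add: asc_def sum_distrib_left sum_subtractf [symmetric] algebra_simps)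
  finally show ?thesis by simp
qed

text \<open>For \<open>n = 0\<close> the truncated \<open>n - 1\<close> is harmless here and below, since its factor \<open>Q ^ n - 1\<close>
  vanishes.\<close>
lemma asc_raise:
  assumes "Q \<noteq> 0"
  shows "(1 - a) * asc Q c n (a * Q) b
       = (1 - a * Q ^ n) * asc Q c n a b + a * (Q ^ n - 1) * asc Q c (n - 1) a b"
proof -
  have w: "(1 - a) * asc_weight Q c (a * Q) b i = (1 - a * Q ^ i) * asc_weight Q c a b i" for i
    using qpoch_shift[of a Q i] by (simp add: asc_weight_def)
  have "(1 - a) * asc Q c n (a * Q) b
      = (\<Sum>i\<le>n. qpoch (inverse (Q ^ n)) Q i * ((1 - a) * asc_weight Q c (a * Q) b i))"
    unfolding asc_def sum_distrib_left by (simp only: mult_ac)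
  also have "\<dots> = asc Q c n a b
      - a * (\<Sum>i\<le>n. qpoch (inverse (Q ^ n)) Q i * asc_weight Q c a b i * Q ^ i)"
    unfolding w by (simp add: asc_def sum_distrib_left sum_subtractf [symmetric] algebra_simps)
  finally show ?thesis
    unfolding asc_insert_power[OF assms] by (simp add: algebra_simps)
qed

text \<open>The three-term recurrence of the Al-Salam--Chihara polynomials in the degree, with
  \<open>a + b\<close> as spectral quantity; \<open>a * b\<close> and \<open>c\<close> are
  parameters that do not depend on \<open>x\<close> when \<rho> is fixed.\<close>

lemma asc_recurrence:
  assumes "Q > 0" "Q \<noteq> 1" and "\<And>i. c * Q ^ i \<noteq> 1"
  shows "(1 - c * Q ^ n) * asc Q c (Suc n) a b
       = (a + b - (a * b + c) * Q ^ n) * asc Q c n a b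
         + a * b * (Q ^ n - 1) * asc Q c (n - 1) a b"
proof -
  define e where "e = qpoch (inverse (Q ^ n)) Q"
  define e' where "e' = qpoch (inverse (Q ^ Suc n)) Q"
  define g where "g = asc_weight Q c a b"
  \<comment> \<open>The sums of \<open>t i\<close> and of \<open>t (Suc i)\<close> agree by telescoping, which reduces the recurrence
    to the identity \<open>coeff\<close> between the individual summands.\<close>
  define t where "t i = (if i = 0 then 0 else
     e (i - 1) * (1 - c * Q ^ (i - 1)) * (1 - Q ^ i) * g i / Q ^ i)" for i
  have Q: "Q \<noteq> 0" using assms by simp
  \<comment> \<open>All sums run up to \<open>Suc n\<close> to fit the higher degree. The vanishing
    of \<open>e (Suc n)\<close> removes the boundary term \<open>t (Suc (Suc n))\<close> and the
    surplus summand in \<open>ins\<close>.\<close>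
  have e0: "e (Suc n) = 0"
    unfolding e_def by (rule qpoch_inverse_power_eq_0) (use Q in auto)
  \<comment> \<open>Dividing \<open>(1 - a * Q ^ i) * (1 - b * Q ^ i)\<close> by
    \<open>Q ^ i\<close> isolates \<open>a + b\<close>, and the term ratio
    \<open>asc_weight_Suc\<close> turns that quotient into \<open>t (Suc i)\<close>.\<close>
  have step: "(a + b) * (e i * g i) = e i * g i / Q ^ i + a * b * (e i * g i * Q ^ i) - t (Suc i)"
    for i
  proof -
    have "t (Suc i) = e i * ((1 - c * Q ^ i) * (1 - Q * Q ^ i) * g (Suc i)) / (Q * Q ^ i)"
      by (simp add: t_def)
    also have "\<dots> = e i * ((1 - a * Q ^ i) * (1 - b * Q ^ i) * g i) / Q ^ i"
      unfolding g_def asc_weight_Suc[OF assms] using Q by simp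
    finally show ?thesis using Q by (simp add: field_simps)
  qed
  have coeff: "e i * g i / Q ^ i - t i
      = (1 - c * Q ^ n) * (e' i * g i) + c * Q ^ n * (e i * g i)" for i
  proof (cases i)
    case 0
    then show ?thesis by (simp add: t_def e_def e'_def algebra_simps)
  next
    case (Suc j)
    have e_i: "e i = e j * (1 - inverse (Q ^ n) * Q ^ j)"
      and e'_i: "e' i = (1 - inverse (Q * Q ^ n)) * e j"
      using qpoch_inverse_power_Suc[OF Q, of n j] by (simp_all add: Suc e_def e'_def qpoch_Suc)
    have t_i: "t i = e j * (1 - c * Q ^ j) * (1 - Q * Q ^ j) * g i / (Q * Q ^ j)"
      by (simp add: t_def Suc)
    have Q_i: "Q ^ i = Q * Q ^ j" by (simp add: Suc)
    show ?thesis
      unfolding e_i e'_i t_i Q_i using Q by (simp add: field_simps)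
  qed
  have F: "asc Q c n a b = (\<Sum>i\<le>Suc n. e i * g i)"
    unfolding e_def g_def by (rule asc_eq_sum) (use Q in auto)
  have F': "asc Q c (Suc n) a b = (\<Sum>i\<le>Suc n. e' i * g i)"
    by (simp add: asc_def e'_def g_def)
  have "(\<Sum>i\<le>Suc n. t (Suc i)) = (\<Sum>i\<le>Suc (Suc n). t i)"
    by (subst (2) sum.atMost_Suc_shift) (simp add: t_def)
  also have "\<dots> = (\<Sum>i\<le>Suc n. t i)"
    using e0 by (simp add: t_def)
  finally have shift: "(\<Sum>i\<le>Suc n. t (Suc i)) = (\<Sum>i\<le>Suc n. t i)" .
  have ins: "(\<Sum>i\<le>Suc n. e i * g i * Q ^ i)
      = Q ^ n * asc Q c n a b - (Q ^ n - 1) * asc Q c (n - 1) a b"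
    using asc_insert_power[OF Q, of n c a b] e0 by (simp add: e_def g_def)
  have "(a + b) * asc Q c n a b = (\<Sum>i\<le>Suc n. (a + b) * (e i * g i))"
    unfolding F by (rule sum_distrib_left)
  also have "\<dots> = (\<Sum>i\<le>Suc n. e i * g i / Q ^ i) + a * b * (\<Sum>i\<le>Suc n. e i * g i * Q ^ i)
      - (\<Sum>i\<le>Suc n. t i)"
    unfolding step sum_subtractf sum.distrib shift by (simp add: sum_distrib_left distrib_left)
  also have "\<dots> = (\<Sum>i\<le>Suc n. e i * g i / Q ^ i - t i)
      + a * b * (\<Sum>i\<le>Suc n. e i * g i * Q ^ i)"
    unfolding sum_subtractf by simp
  also have "\<dots> = (1 - c * Q ^ n) * asc Q c (Suc n) a b + c * Q ^ n * asc Q c n a b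
      + a * b * (Q ^ n * asc Q c n a b - (Q ^ n - 1) * asc Q c (n - 1) a b)"
    unfolding coeff ins sum.distrib F F' sum_distrib_left [symmetric] ..
  finally show ?thesis by (simp add: algebra_simps)
qed

lemma continuous_asc: "continuous_on UNIV (\<lambda>b. asc Q c n a b)"
  unfolding asc_def asc_weight_def qpoch_def divide_inverse
  by (intro continuous_intros continuous_on_const)

text \<open>The inverse of \<open>asc_raise\<close>. Put \<open>b = \<beta> * Q\<close>: raising
  \<beta> in degrees \<open>n\<close> and \<open>Suc n\<close> expresses the right side at \<beta>,
  the recurrence eliminates degree \<open>Suc n\<close>, and then the terms of degree
  \<open>n - 1\<close> cancel.\<close>

lemma asc_lower:
  assumes "Q > 0" "Q \<noteq> 1" and "\<And>i. c * Q ^ i \<noteq> 1"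
  shows "Q ^ n * (b - c) * asc Q c n a (b / Q)
       = (1 - c * Q ^ n) * asc Q c (Suc n) a b - a * (1 - b * Q ^ n) * asc Q c n a b"
proof -
  let ?L = "\<lambda>\<beta>. Q ^ n * (\<beta> * Q - c) * asc Q c n a \<beta>"
  let ?R = "\<lambda>\<beta>. (1 - c * Q ^ n) * asc Q c (Suc n) a (\<beta> * Q)
           - a * (1 - \<beta> * Q * Q ^ n) * asc Q c n a (\<beta> * Q)"
  have generic: "?L \<beta> = ?R \<beta>" if "\<beta> \<noteq> 1" for \<beta>
  proof -
    have 1: "(1 - \<beta>) * asc Q c m a (\<beta> * Q)
         = (1 - \<beta> * Q ^ m) * asc Q c m a \<beta> + \<beta> * (Q ^ m - 1) * asc Q c (m - 1) a \<beta>" for m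
      using asc_raise[of Q \<beta> c m a] assms(1) by (simp add: asc_commute)
    have 2: "(1 - \<beta>) * asc Q c (Suc n) a (\<beta> * Q)
         = (1 - \<beta> * Q * Q ^ n) * asc Q c (Suc n) a \<beta> + \<beta> * (Q * Q ^ n - 1) * asc Q c n a \<beta>"
      using 1[of "Suc n"] by (simp add: mult_ac)
    note 3 = asc_recurrence[OF assms, of n a \<beta>]
    have "(1 - \<beta>) * (N * (\<beta> * Q - c) * f) = (1 - \<beta>) * ((1 - c * N) * F' - a * (1 - \<beta> * Q * N) * F)"
      if "(1 - \<beta>) * F = (1 - \<beta> * N) * f + \<beta> * (N - 1) * f0"
        and "(1 - \<beta>) * F' = (1 - \<beta> * Q * N) * f1 + \<beta> * (Q * N - 1) * f"
        and "(1 - c * N) * f1 = (a + \<beta> - (a * \<beta> + c) * N) * f + a * \<beta> * (N - 1) * f0"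
      for N f f0 f1 F F' :: real
      using that by algebra
    from this[OF 1[of n] 2 3] have "(1 - \<beta>) * ?L \<beta> = (1 - \<beta>) * ?R \<beta>" .
    then show ?thesis using that by simp
  qed
  \<comment> \<open>At \<open>\<beta> = 1\<close> the factor \<open>1 - \<beta>\<close> cannot be cancelled, but both sides are continuous in \<open>\<beta>\<close>.\<close>
  have cont: "continuous_on UNIV (\<lambda>\<beta>. ?L \<beta> - ?R \<beta>)"
    by (intro continuous_intros continuous_on_compose2[OF continuous_asc]) auto
  have "((\<lambda>\<beta>. ?L \<beta> - ?R \<beta>) \<longlongrightarrow> ?L 1 - ?R 1) (at 1)"
    using cont unfolding continuous_on_def by blast
  moreover have "((\<lambda>\<beta>. ?L \<beta> - ?R \<beta>) \<longlongrightarrow> 0) (at 1)"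
    by (rule tendsto_eventually) (use generic in \<open>auto simp: eventually_at_filter\<close>)
  ultimately have "?L 1 = ?R 1"
    using tendsto_unique[of "at (1::real)"] by fastforce
  with generic have "?L \<beta> = ?R \<beta>" for \<beta>
    by (cases "\<beta> = 1") blast+
  from this[of "b / Q"] show ?thesis
    using assms(1) by simp
qed

text \<open>Lowering either argument of the series at \<open>(a * Q, b)\<close> by
  \<open>asc_lower\<close> produces the same term of degree \<open>Suc n\<close>; the difference of
  the two relations no longer changes the degree.\<close>

lemma asc_exchange:
  assumes "Q > 0" "Q \<noteq> 1" and "\<And>i. c * Q ^ i \<noteq> 1"
  shows "Q ^ n * (b - c) * asc Q c n (a * Q) (b / Q)
       = (b - a * Q) * asc Q c n (a * Q) b - Q ^ n * (c - a * Q) * asc Q c n a b"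
proof -
  have "Q ^ n * (a * Q - c) * asc Q c n a b
       = (1 - c * Q ^ n) * asc Q c (Suc n) (a * Q) b
         - b * (1 - a * Q * Q ^ n) * asc Q c n (a * Q) b"
    using asc_lower[OF assms, of n "a * Q" b] assms(1) by (simp add: asc_commute)
  then show ?thesis
    using asc_lower[OF assms, of n b "a * Q"] by (simp add: algebra_simps)
qed

text \<open>Serves the first site for both directions of a dual hop: the right hop as it stands, the
  left hop with \<open>a\<close> and \<open>b\<close> interchanged.\<close>

lemma asc_exchange_raise:
  assumes "Q > 0" "Q \<noteq> 1" and "\<And>i. c * Q ^ i \<noteq> 1"
  shows "Q ^ n * (b - c) * (1 - a) * asc Q c n (a * Q) (b / Q)
       = (b - a * Q) * ((1 - a * Q ^ n) * asc Q c n a b + a * (Q ^ n - 1) * asc Q c (n - 1) a b)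
         - Q ^ n * (1 - a) * (c - a * Q) * asc Q c n a b"
proof -
  have "Q ^ n * (b - c) * (1 - a) * asc Q c n (a * Q) (b / Q)
       = (1 - a) * (Q ^ n * (b - c) * asc Q c n (a * Q) (b / Q))"
    by (simp only: mult_ac)
  also have "\<dots> = (b - a * Q) * ((1 - a) * asc Q c n (a * Q) b)
       - Q ^ n * (1 - a) * (c - a * Q) * asc Q c n a b"
    unfolding asc_exchange[OF assms] by (simp add: algebra_simps)
  also have "(1 - a) * asc Q c n (a * Q) b
      = (1 - a * Q ^ n) * asc Q c n a b + a * (Q ^ n - 1) * asc Q c (n - 1) a b"
    by (rule asc_raise) (use assms in simp)
  finally show ?thesis .
qed

text \<open>Lowering \<open>b\<close> and then \<open>a\<close> leads up to degree
  \<open>n + 2\<close> at \<open>(a, b)\<close>, which the recurrence removes. This is the second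
  site in a right hop, where the particle number grows and the boundary height drops by 2.\<close>

lemma asc_lower_both:
  assumes "Q > 0" "Q \<noteq> 1" and "\<And>i. c * Q ^ i \<noteq> 1"
  shows "Q * Q ^ n * (a - c) * (b - c) * asc Q c n (a / Q) (b / Q)
       = (1 - c * Q ^ n) * (a * b - c * Q) * asc Q c (Suc n) a b
         + a * b * (Q + c - a - b + (a * b - c * Q) * Q ^ n) * asc Q c n a b"
proof -
  have 1: "Q ^ n * (b - c) * asc Q c n (a / Q) (b / Q)
       = (1 - c * Q ^ n) * asc Q c (Suc n) (a / Q) b
         - a / Q * (1 - b * Q ^ n) * asc Q c n (a / Q) b"
    by (rule asc_lower[OF assms])
  have 2: "Q ^ m * (a - c) * asc Q c m (a / Q) b
       = (1 - c * Q ^ m) * asc Q c (Suc m) a b - b * (1 - a * Q ^ m) * asc Q c m a b" for m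
    using asc_lower[OF assms, of m a b] by (simp add: asc_commute)
  have 3: "Q * Q ^ n * (a - c) * asc Q c (Suc n) (a / Q) b
       = (1 - c * (Q * Q ^ n)) * asc Q c (Suc (Suc n)) a b
         - b * (1 - a * (Q * Q ^ n)) * asc Q c (Suc n) a b"
    using 2[of "Suc n"] by simp
  have 4: "(1 - c * (Q * Q ^ n)) * asc Q c (Suc (Suc n)) a b
       = (a + b - (a * b + c) * (Q * Q ^ n)) * asc Q c (Suc n) a b
         + a * b * (Q * Q ^ n - 1) * asc Q c n a b"
    using asc_recurrence[OF assms, of "Suc n" a b] by simp
  \<comment> \<open>Each of the two lowerings brings a factor \<open>Q ^ n\<close>, so the
    elimination yields the claim multiplied by \<open>N\<close>, which is cancelled at the
    end.\<close>
  have *: "N * (Q * N * (a - c) * (b - c) * h) = N * ((1 - c * N) * (a * b - c * Q) * F1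
         + a * b * (Q + c - a - b + (a * b - c * Q) * N) * F)"
    if "N * (b - c) * h = (1 - c * N) * f1 - a / Q * (1 - b * N) * f"
      and "N * (a - c) * f = (1 - c * N) * F1 - b * (1 - a * N) * F"
      and "Q * N * (a - c) * f1 = (1 - c * (Q * N)) * F2 - b * (1 - a * (Q * N)) * F1"
      and "(1 - c * (Q * N)) * F2 = (a + b - (a * b + c) * (Q * N)) * F1
         + a * b * (Q * N - 1) * F"
    for N h f f1 F F1 F2
  proof -
    have "Q * (N * (b - c) * h) = Q * (1 - c * N) * f1 - a * (1 - b * N) * f"
      unfolding that(1) using assms(1) by (simp add: field_simps)
    with that(2-4) show ?thesis by algebra
  qed
  show ?thesis
    using *[OF 1 2[of n] 3 4] assms(1) by simp
qed

text \<open>Raising \<open>a\<close> and then \<open>b\<close> leads down to degree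
  \<open>n - 2\<close>, which the recurrence in degree \<open>n - 1\<close> removes; hence the
  separate case \<open>n = 0\<close>.\<close>

lemma asc_raise_both:
  assumes "Q > 0" "Q \<noteq> 1" and "\<And>i. c * Q ^ i \<noteq> 1"
  shows "(1 - a) * (1 - b) * Q * asc Q c n (a * Q) (b * Q)
       = Q ^ n * ((Q + c - (a + b) * Q + (a * b * Q - c) * Q ^ n) * asc Q c n a b
         + (Q ^ n - 1) * (c - a * b * Q) * asc Q c (n - 1) a b)"
proof (cases n)
  case 0
  then show ?thesis by (simp add: algebra_simps)
next
  case (Suc m)
  have Q: "Q \<noteq> 0" using assms by simp
  have 1: "(1 - a) * asc Q c n (a * Q) (b * Q)
       = (1 - a * Q ^ n) * asc Q c n a (b * Q) + a * (Q ^ n - 1) * asc Q c m a (b * Q)"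
    using asc_raise[OF Q, of a c n "b * Q"] by (simp add: Suc)
  have 2: "(1 - b) * asc Q c l a (b * Q)
       = (1 - b * Q ^ l) * asc Q c l a b + b * (Q ^ l - 1) * asc Q c (l - 1) a b" for l
    using asc_raise[OF Q, of b c l a] by (simp add: asc_commute)
  have 3: "(1 - b) * asc Q c n a (b * Q)
       = (1 - b * Q ^ n) * asc Q c n a b + b * (Q ^ n - 1) * asc Q c m a b"
    using 2[of n] by (simp add: Suc)
  have 4: "(1 - c * Q ^ m) * asc Q c n a b
       = (a + b - (a * b + c) * Q ^ m) * asc Q c m a b
         + a * b * (Q ^ m - 1) * asc Q c (m - 1) a b"
    using asc_recurrence[OF assms, of m a b] by (simp add: Suc)
  have *: "(1 - a) * (1 - b) * Q * h
       = N * ((Q + c - (a + b) * Q + (a * b * Q - c) * N) * F + (N - 1) * (c - a * b * Q) * F1)"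
    if "(1 - a) * h = (1 - a * N) * f + a * (N - 1) * f1"
      and "(1 - b) * f = (1 - b * N) * F + b * (N - 1) * F1"
      and "(1 - b) * f1 = (1 - b * L) * F1 + b * (L - 1) * F2"
      and "(1 - c * L) * F = (a + b - (a * b + c) * L) * F1 + a * b * (L - 1) * F2"
      and "N = Q * L"
    for N L h f f1 F F1 F2
    using that by algebra
  show ?thesis
    using *[OF 1 3 2[of m] 4] by (simp add: Suc)
qed

section \<open>The identity for two sites\<close>

text \<open>\<open>s\<close> stands for \<open>a2 + b2\<close>; the product \<open>a2 b2 = b c2 / a\<close> has been eliminated.\<close>
lemma two_site_polynomial:
  fixes a b c1 c2 N1 N2 Q s f fm g gm :: real
  defines "D \<equiv> b - a" and "E \<equiv> b - a * Q" and "E' \<equiv> b * Q - a"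
  defines "R \<equiv> (a + b - (a * b + c1) * N1) * f + a * b * (N1 - 1) * fm"
    and "S \<equiv> (a * s - c2 * (a + b) * N2) * g + b * c2 * (N2 - 1) * gm"
    and "U \<equiv> E * ((1 - a * N1) * f + a * (N1 - 1) * fm) - N1 * (1 - a) * (c1 - a * Q) * f"
    and "V \<equiv> - E' * ((1 - b * N1) * f + b * (N1 - 1) * fm) - N1 * (1 - b) * (c1 - b * Q) * f"
  shows "D * E * E' * (a * Q * (1 - N1) * (fm * S + (c2 * N2 - 1) * (f * g))
           - c2 * (N2 - 1) * (R * gm + a * (c1 * N1 - 1) * (f * g)))
       = - E' * U * (E * S + b * (a * (Q + c2 - s) + c2 * E * N2) * g)
         - a * E * V * ((a * (Q + c2 - s * Q) + c2 * E' * N2) * g - (N2 - 1) * c2 * E' * gm)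
         - (a * N1 * Q * E' * (1 - a) * (b - c1) * (a * (s - c2) - b)
            + a * N1 * Q * E * (c1 - a) * (b - 1) * (a * (s - 1) - b * c2)) * (f * g)"
  unfolding D_def E_def E'_def R_def S_def U_def V_def
  by algebra

text \<open>\<open>f\<close> and \<open>g\<close> are the values of the polynomials at the two sites; the suffixes \<open>m\<close> and \<open>p\<close>
  mean that \<open>n\<close> is lowered or raised, \<open>X\<close> and \<open>Y\<close> that a dual particle moved to the right or
  to the left.\<close>
lemma two_site_generic:
  fixes a1 a2 b1 b2 c1 c2 N1 N2 Q :: real
  assumes nz: "a1 \<noteq> 0" "a2 \<noteq> 0" "c1 \<noteq> 0" "c2 \<noteq> 0" "N1 \<noteq> 0" "N2 \<noteq> 0" "Q \<noteq> 0"
    and D: "b1 \<noteq> a1" "b1 \<noteq> a1 * Q" "b1 * Q \<noteq> a1"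
    and b2: "b1 * c2 = a1 * a2 * b2"
    and f: "(1 - c1 * N1) * fp = (a1 + b1 - (a1 * b1 + c1) * N1) * f + a1 * b1 * (N1 - 1) * fm"
    and g: "(1 - c2 * N2) * gp = (a2 + b2 - (a2 * b2 + c2) * N2) * g + a2 * b2 * (N2 - 1) * gm"
    and f1: "N1 * (b1 - c1) * (1 - a1) * fX = (b1 - a1 * Q) * ((1 - a1 * N1) * f + a1 * (N1 - 1) * fm)
       - N1 * (1 - a1) * (c1 - a1 * Q) * f"
    and f2: "N1 * (a1 - c1) * (1 - b1) * fY = (a1 - b1 * Q) * ((1 - b1 * N1) * f + b1 * (N1 - 1) * fm)
       - N1 * (1 - b1) * (c1 - b1 * Q) * f"
    and g1: "Q * N2 * (a2 - c2) * (b2 - c2) * gX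
       = (1 - c2 * N2) * (a2 * b2 - c2 * Q) * gp
         + a2 * b2 * (Q + c2 - a2 - b2 + (a2 * b2 - c2 * Q) * N2) * g"
    and g2: "(1 - a2) * (1 - b2) * Q * gY
       = N2 * ((Q + c2 - (a2 + b2) * Q + (a2 * b2 * Q - c2) * N2) * g
         + (N2 - 1) * (c2 - a2 * b2 * Q) * gm)"
    and Cp: "a2 * (b1 - a1) * (b1 - a1 * Q) * Cp
       = (1 - a1) * (c2 - a2) * (b1 - c1) * (b1 - a1 * a2)"
    and Cm: "a2 * (b1 - a1) * (b1 * Q - a1) * Cm
       = (1 - a2) * (c1 - a1) * (b1 - 1) * (b1 * c2 - a1 * a2)"
  shows "(1 - 1 / N1) * (c2 * N2 - 1) * (a1 * fm * gp - f * g)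
       + c2 / Q * (N2 - 1) * (c1 - 1 / N1) * (fp * gm / a1 - f * g)
       = Cp * (N2 * fX * gX - f * g) + Cm * (fY * gY / N2 - f * g)"
proof -
  define D where "D = b1 - a1"
  define E where "E = b1 - a1 * Q"
  define E' where "E' = b1 * Q - a1"
  define s where "s = a2 + b2"
  define U where "U = E * ((1 - a1 * N1) * f + a1 * (N1 - 1) * fm)
       - N1 * (1 - a1) * (c1 - a1 * Q) * f"
  define V where "V = - E' * ((1 - b1 * N1) * f + b1 * (N1 - 1) * fm)
       - N1 * (1 - b1) * (c1 - b1 * Q) * f"
  define R where "R = (a1 + b1 - (a1 * b1 + c1) * N1) * f + a1 * b1 * (N1 - 1) * fm"
  define S where "S = (a1 * s - c2 * (a1 + b1) * N2) * g + b1 * c2 * (N2 - 1) * gm"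
  define W where "W = E * S + b1 * (a1 * (Q + c2 - s) + c2 * E * N2) * g"
  define Z where "Z = (a1 * (Q + c2 - s * Q) + c2 * E' * N2) * g - (N2 - 1) * c2 * E' * gm"
  \<comment> \<open>\<open>K\<close> clears every denominator: \<open>a1\<close>, \<open>N1\<close>
    and \<open>Q\<close> from the particle side, \<open>D\<close>, \<open>E\<close> and
    \<open>E'\<close> from the dynamic rates.\<close>
  define K where "K = a1 * N1 * Q * D * E * E'"
  have K: "K \<noteq> 0" using nz D by (simp add: K_def D_def E_def E'_def)
  have p: "a1 * (a2 * b2) = b1 * c2" using b2 by simp
  have S: "a1 * ((1 - c2 * N2) * gp) = S"
    unfolding g S_def s_def using p by algebra
  have R: "(1 - c1 * N1) * fp = R" unfolding f R_def ..
  have gX: "a1 * a1 * (Q * N2 * (a2 - c2) * (b2 - c2) * gX) = c2 * W"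
  proof -
    have "a1 * (a1 * (Q * N2 * (a2 - c2) * (b2 - c2) * gX))
        = a1 * ((1 - c2 * N2) * gp) * (a1 * (a2 * b2) - a1 * c2 * Q)
         + a1 * (a2 * b2) * (a1 * (Q + c2 - s) + (a1 * (a2 * b2) - a1 * c2 * Q) * N2) * g"
      unfolding g1 s_def by (simp add: algebra_simps)
    also have "\<dots> = c2 * W"
      unfolding S p W_def E_def by (simp add: algebra_simps)
    finally show ?thesis by (simp add: mult.assoc)
  qed
  have gY: "a1 * ((1 - a2) * (1 - b2) * Q * gY) = N2 * Z"
  proof -
    have "a1 * ((1 - a2) * (1 - b2) * Q * gY)
       = N2 * ((a1 * (Q + c2 - s * Q) + (a1 * (a2 * b2) * Q - a1 * c2) * N2) * g
         + (N2 - 1) * (a1 * c2 - a1 * (a2 * b2) * Q) * gm)"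
      unfolding g2 s_def by (simp add: algebra_simps)
    also have "\<dots> = N2 * Z"
      unfolding p Z_def E'_def by (simp add: algebra_simps)
    finally show ?thesis .
  qed
  have fX: "N1 * (b1 - c1) * (1 - a1) * fX = U"
    unfolding f1 U_def E_def ..
  have fY: "N1 * (a1 - c1) * (1 - b1) * fY = V"
    unfolding f2 V_def E'_def by simp
  have Cp1: "a2 * (D * E * Cp) = (1 - a1) * (c2 - a2) * (b1 - c1) * (b1 - a1 * a2)"
    using Cp by (simp add: D_def E_def mult_ac)
  have Cm1: "a2 * (D * E' * Cm) = (1 - a2) * (c1 - a1) * (b1 - 1) * (b1 * c2 - a1 * a2)"
    using Cm by (simp add: D_def E'_def mult_ac)
  \<comment> \<open>Each rate is needed in two forms. This one exhibits the prefactors of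
    \<open>fX\<close> and \<open>gX\<close>, so that the hop term becomes the product of
    \<open>U\<close> and \<open>W\<close>.\<close>
  have "a2 * c2 * (D * E * Cp) = a2 * (a1 * (1 - a1) * (c2 - a2) * (b1 - c1) * (b2 - c2))"
    using Cp1 p by algebra
  then have Cp2: "c2 * (D * E * Cp) = a1 * (1 - a1) * (c2 - a2) * (b1 - c1) * (b2 - c2)"
    using nz by simp
  have "a2 * (D * E' * Cm) = a2 * (a1 * (1 - a2) * (c1 - a1) * (b1 - 1) * (b2 - 1))"
    using Cm1 p by algebra
  then have Cm2: "D * E' * Cm = a1 * (1 - a2) * (c1 - a1) * (b1 - 1) * (b2 - 1)"
    using nz by simp
  \<comment> \<open>The second form is for the diagonal term, where \<open>a2\<close> and
    \<open>b2\<close> may occur only through their sum \<open>s\<close>.\<close>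
  have "c2 * (D * E * Cp) = c2 * ((1 - a1) * (b1 - c1) * (a1 * (s - c2) - b1))"
    unfolding Cp2 s_def using p by algebra
  then have Cp3: "D * E * Cp = (1 - a1) * (b1 - c1) * (a1 * (s - c2) - b1)"
    using nz by simp
  have Cm3: "D * E' * Cm = (c1 - a1) * (b1 - 1) * (a1 * (s - 1) - b1 * c2)"
    unfolding Cm2 s_def using p by algebra
  have "c2 * (D * E * Cp) * (N1 * N2 * Q * a1 * fX * gX) = - U * (a1 * a1 * (Q * N2 * (a2 - c2) * (b2 - c2) * gX))"
    unfolding Cp2 fX [symmetric] by (simp add: algebra_simps)
  then have "c2 * ((D * E * Cp) * (N1 * N2 * Q * a1 * fX * gX)) = c2 * (- U * W)"
    unfolding gX by (simp add: mult_ac)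
  then have "(D * E * Cp) * (N1 * N2 * Q * a1 * fX * gX) = - U * W"
    using nz(4) mult_left_cancel by blast
  then have X: "K * (Cp * (N2 * fX * gX)) = - E' * U * W"
    unfolding K_def by algebra
  have "(D * E' * Cm) * (N1 * Q * fY * gY) = - V * (a1 * ((1 - a2) * (1 - b2) * Q * gY))"
    unfolding Cm2 fY [symmetric] by (simp add: algebra_simps)
  then have "(D * E' * Cm) * (N1 * Q * fY * gY) / N2 = - V * Z"
    unfolding gY using nz by (simp add: mult_ac)
  then have "a1 * E * ((D * E' * Cm) * (N1 * Q * fY * gY) / N2) = a1 * E * (- V * Z)"
    by (rule arg_cong)
  then have Y: "K * (Cm * (fY * gY / N2)) = - a1 * E * V * Z"
    unfolding K_def by (simp add: mult_ac)
  have CC: "K * (Cp * (f * g) + Cm * (f * g))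
      = (a1 * N1 * Q * E' * (1 - a1) * (b1 - c1) * (a1 * (s - c2) - b1)
            + a1 * N1 * Q * E * (c1 - a1) * (b1 - 1) * (a1 * (s - 1) - b1 * c2)) * (f * g)"
    unfolding K_def using Cp3 Cm3 by algebra
  have "K * ((1 - 1 / N1) * (c2 * N2 - 1) * (a1 * fm * gp - f * g))
      = D * E * E' * (a1 * Q * (1 - N1) * (fm * (a1 * ((1 - c2 * N2) * gp)) + (c2 * N2 - 1) * (f * g)))"
    unfolding K_def using nz by (simp add: divide_simps) (simp add: algebra_simps)
  moreover have "K * (c2 / Q * (N2 - 1) * (c1 - 1 / N1) * (fp * gm / a1 - f * g))
      = - D * E * E' * (c2 * (N2 - 1) * (((1 - c1 * N1) * fp) * gm + a1 * (c1 * N1 - 1) * (f * g)))"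
    unfolding K_def using nz by (simp add: divide_simps) (simp add: algebra_simps)
  ultimately have
    "K * ((1 - 1 / N1) * (c2 * N2 - 1) * (a1 * fm * gp - f * g)
        + c2 / Q * (N2 - 1) * (c1 - 1 / N1) * (fp * gm / a1 - f * g))
      = D * E * E' * (a1 * Q * (1 - N1) * (fm * S + (c2 * N2 - 1) * (f * g))
           - c2 * (N2 - 1) * (R * gm + a1 * (c1 * N1 - 1) * (f * g)))"
    unfolding S R distrib_left by (simp add: algebra_simps)
  also have "\<dots> = K * (Cp * (N2 * fX * gX)) + K * (Cm * (fY * gY / N2))
      - K * (Cp * (f * g) + Cm * (f * g))"
    unfolding X Y CC W_def Z_def unfolding S_def R_def U_def V_def D_def E_def E'_def
    by (subst two_site_polynomial) simp
  also have "\<dots> = K * (Cp * (N2 * fX * gX - f * g) + Cm * (fY * gY / N2 - f * g))"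
    by (simp add: algebra_simps)
  finally show ?thesis using K by simp
qed

text \<open>If \<open>\<zeta>\<close> is empty at the first or second site, then one factor is identically \<open>1\<close>, and
  the corresponding rate vanishes although its denominator may vanish as well.\<close>
lemma two_site_first_empty:
  fixes a2 b1 b2 c1 c2 N1 N2 Q :: real
  assumes nz: "a2 \<noteq> 0" "N1 \<noteq> 0" "N2 \<noteq> 0" "Q \<noteq> 0"
    and D: "b1 * Q \<noteq> 1" and c1: "c1 \<noteq> 1"
    and b2: "b1 * c2 = a2 * b2"
    and g: "(1 - c2 * N2) * gp = (a2 + b2 - (a2 * b2 + c2) * N2) * g + a2 * b2 * (N2 - 1) * gm"
    and f2: "N1 * (1 - c1) * fY = (1 - b1 * Q) - N1 * (c1 - b1 * Q)"
    and g2: "(1 - a2) * (1 - b2) * Q * gY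
       = N2 * ((Q + c2 - (a2 + b2) * Q + (a2 * b2 * Q - c2) * N2) * g
         + (N2 - 1) * (c2 - a2 * b2 * Q) * gm)"
    and Cm: "a2 * (b1 * Q - 1) * Cm = (1 - a2) * (c1 - 1) * (b1 * c2 - a2)"
  shows "(1 - 1 / N1) * (c2 * N2 - 1) * (gp - g)
       + c2 / Q * (N2 - 1) * (c1 - 1 / N1) * (gm - g)
       = Cm * (fY * gY / N2 - g)"
proof -
  have "a2 * ((b1 * Q - 1) * Cm) = a2 * ((1 - a2) * (c1 - 1) * (b2 - 1))"
    using Cm b2 by algebra
  then have Cm1: "(b1 * Q - 1) * Cm = (1 - a2) * (c1 - 1) * (b2 - 1)"
    using nz by simp
  define K where "K = N1 * Q * (b1 * Q - 1)"
  have K: "K \<noteq> 0" using nz D by (simp add: K_def)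
  have "K * (Cm * (fY * gY / N2))
      = (N1 * (1 - c1) * fY) * (((1 - a2) * (1 - b2) * Q * gY) / N2)"
    using Cm1 unfolding K_def by (simp add: field_simps) algebra
  also have "\<dots> = ((1 - b1 * Q) - N1 * (c1 - b1 * Q)) *
     ((Q + c2 - (a2 + b2) * Q + (a2 * b2 * Q - c2) * N2) * g
         + (N2 - 1) * (c2 - a2 * b2 * Q) * gm)"
    unfolding f2 g2 using nz by simp
  finally have Y: "K * (Cm * (fY * gY / N2)) = \<dots>" .
  have "K * ((1 - 1 / N1) * (c2 * N2 - 1) * (gp - g)
       + c2 / Q * (N2 - 1) * (c1 - 1 / N1) * (gm - g))
      = (b1 * Q - 1) * (Q * (1 - N1) * ((1 - c2 * N2) * gp + (c2 * N2 - 1) * g)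
         + c2 * (N2 - 1) * (c1 * N1 - 1) * (gm - g))"
    unfolding K_def using nz by (simp add: divide_simps) (simp add: algebra_simps)
  also have "\<dots> = K * (Cm * (fY * gY / N2)) - K * (Cm * g)"
    unfolding Y unfolding g K_def using b2 Cm1 by algebra
  finally have "K * ((1 - 1 / N1) * (c2 * N2 - 1) * (gp - g)
       + c2 / Q * (N2 - 1) * (c1 - 1 / N1) * (gm - g)) = K * (Cm * (fY * gY / N2 - g))"
    by (simp add: algebra_simps)
  then show ?thesis using K by simp
qed

lemma two_site_second_empty:
  fixes a1 b1 b2 c1 c2 N1 N2 Q :: real
  assumes nz: "a1 \<noteq> 0" "c2 \<noteq> 0" "N1 \<noteq> 0" "N2 \<noteq> 0" "Q \<noteq> 0"
    and D: "b1 \<noteq> a1" "b1 \<noteq> a1 * Q"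
    and b2: "b1 * c2 = a1 * b2"
    and f: "(1 - c1 * N1) * fp = (a1 + b1 - (a1 * b1 + c1) * N1) * f + a1 * b1 * (N1 - 1) * fm"
    and f1: "N1 * (b1 - c1) * (1 - a1) * fX = (b1 - a1 * Q) * ((1 - a1 * N1) * f + a1 * (N1 - 1) * fm)
       - N1 * (1 - a1) * (c1 - a1 * Q) * f"
    and g1: "Q * N2 * (1 - c2) * (b2 - c2) * gX
       = (1 - c2 * N2) * (b2 - c2 * Q) + b2 * (Q + c2 - 1 - b2 + (b2 - c2 * Q) * N2)"
    and Cp: "(b1 - a1) * (b1 - a1 * Q) * Cp = (1 - a1) * (c2 - 1) * (b1 - c1) * (b1 - a1)"
  shows "(1 - 1 / N1) * (c2 * N2 - 1) * (a1 * fm - f)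
       + c2 / Q * (N2 - 1) * (c1 - 1 / N1) * (fp / a1 - f)
       = Cp * (N2 * fX * gX - f)"
proof -
  define E where "E = b1 - a1 * Q"
  define U where "U = E * ((1 - a1 * N1) * f + a1 * (N1 - 1) * fm)
       - N1 * (1 - a1) * (c1 - a1 * Q) * f"
  have E: "E \<noteq> 0" using D by (simp add: E_def)
  have Cp1: "E * Cp = (1 - a1) * (c2 - 1) * (b1 - c1)"
    using Cp D by (simp add: E_def)
  have fX: "N1 * (b1 - c1) * (1 - a1) * fX = U"
    unfolding f1 U_def E_def ..
  \<comment> \<open>Since \<open>a2 = 1\<close>, the equation \<open>b2 = c2\<close> would force
    \<open>b1 = a1\<close>. The common factor \<open>b2 - c2\<close> of \<open>g1\<close> can
    therefore be cancelled.\<close>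
  have "b2 \<noteq> c2" using b2 D nz by (metis mult.commute mult_right_cancel)
  moreover have "(b2 - c2) * (Q * N2 * (1 - c2) * gX) = (b2 - c2) * (N2 * (b2 - c2 * Q) + Q - b2)"
    using g1 by (simp add: algebra_simps)
  ultimately have "Q * N2 * (1 - c2) * gX = N2 * (b2 - c2 * Q) + Q - b2"
    by simp
  then have gX: "a1 * (Q * N2 * (1 - c2) * gX) = N2 * c2 * E + a1 * Q - b1 * c2"
    using b2 unfolding E_def by algebra
  define K where "K = a1 * N1 * Q * E"
  have K: "K \<noteq> 0" using nz E by (simp add: K_def)
  have X: "K * (Cp * (N2 * fX * gX)) = - U * (N2 * c2 * E + a1 * Q - b1 * c2)"
    using Cp1 unfolding K_def fX [symmetric] gX [symmetric] by algebra
  have "K * ((1 - 1 / N1) * (c2 * N2 - 1) * (a1 * fm - f)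
       + c2 / Q * (N2 - 1) * (c1 - 1 / N1) * (fp / a1 - f))
      = E * (a1 * Q * (N1 - 1) * (c2 * N2 - 1) * (a1 * fm - f)
         - c2 * (N2 - 1) * ((1 - c1 * N1) * fp + a1 * (c1 * N1 - 1) * f))"
    unfolding K_def using nz by (simp add: divide_simps) (simp add: algebra_simps)
  also have "\<dots> = K * (Cp * (N2 * fX * gX)) - K * (Cp * f)"
    unfolding X unfolding f K_def U_def using Cp1 unfolding E_def by algebra
  finally have "K * ((1 - 1 / N1) * (c2 * N2 - 1) * (a1 * fm - f)
       + c2 / Q * (N2 - 1) * (c1 - 1 / N1) * (fp / a1 - f)) = K * (Cp * (N2 * fX * gX - f))"
    by (simp add: algebra_simps)
  then show ?thesis using K by simp
qed

section \<open>Factorization of the rates in multiplicative variables\<close>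

lemma qnum_eq:
  assumes "q > 0"
  shows "qnum q y = (inverse q powr y - inverse (inverse q powr y)) / (inverse q - q)"
proof -
  have "inverse q powr y = q powr - y" "inverse (inverse q powr y) = q powr y"
    using assms by (simp_all add: powr_minus inverse_powr)
  then show ?thesis
    unfolding qnum_def by (metis minus_diff_eq minus_divide_divide)
qed

text \<open>Here \<open>r = inverse q\<close>, \<open>d = r - q\<close>, and \<open>m1\<close>,
  \<open>m2\<close>, \<kappa>1, \<kappa>2 are \<open>r\<close> to the powers \<open>n1\<close>,
  \<open>n2\<close>, \<open>k1\<close>, \<open>k2\<close>. The constant
  \<open>r / (\<kappa>1 * \<kappa>2 * d\<^sup>2)\<close> is the same for all four rates of a bond
  and so drops out of the duality relation.\<close>

lemma asip_rates_factor:
  fixes r d n1 n2 m1 m2 :: real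
  assumes "r > 0" "m1 > 0" "m2 > 0" "\<kappa>1 > 0" "\<kappa>2 > 0" "d \<noteq> 0"
  shows "inverse (m1 * \<kappa>1 / (m2 * r)) * ((m1 - inverse m1) / d) *
           ((m2 * \<kappa>2 - inverse (m2 * \<kappa>2)) / d)
       = r / (\<kappa>1 * \<kappa>2 * d\<^sup>2) * ((1 - 1 / m1\<^sup>2) * (\<kappa>2\<^sup>2 * m2\<^sup>2 - 1))"
    and "(m2 * \<kappa>2 / (m1 * r)) * ((m2 - inverse m2) / d) *
           ((m1 * \<kappa>1 - inverse (m1 * \<kappa>1)) / d)
       = r / (\<kappa>1 * \<kappa>2 * d\<^sup>2) * (\<kappa>2\<^sup>2 / r\<^sup>2 * (m2\<^sup>2 - 1) * (\<kappa>1\<^sup>2 - 1 / m1\<^sup>2))"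
  using assms by (simp_all add: field_simps power2_eq_square)

text \<open>Here \<open>y1\<close>, \<open>y2\<close>, \<rho>, \<open>h\<close> stand for
  \<open>r\<close> to the powers \<open>x1\<close>, \<open>x2\<close>, left height, middle height.
  Up to nonzero factors, \<open>b1 - a1\<close>, \<open>b1 - a1 * r\<^sup>2\<close> and
  \<open>b1 * r\<^sup>2 - a1\<close> are the q-numbers of the middle height, of it minus 1 and of it
  plus 1, that is, the denominators of the rates.\<close>

lemma dynamic_rates_factor:
  fixes r d y1 y2 \<kappa>1 \<kappa>2 h :: real
  assumes "r > 0" "y1 > 0" "y2 > 0" "\<kappa>1 > 0" "\<kappa>2 > 0" "\<rho> > 0" "d \<noteq> 0"
    and "h = \<rho> * y1\<^sup>2 * \<kappa>1"
    and "a1 = inverse (y1\<^sup>2)" "a2 = inverse (y2\<^sup>2)" "b1 = y1\<^sup>2 * \<rho>\<^sup>2 * \<kappa>1\<^sup>2"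
  shows "b1 \<noteq> a1 \<Longrightarrow> b1 \<noteq> a1 * r\<^sup>2 \<Longrightarrow>
      a2 * (b1 - a1) * (b1 - a1 * r\<^sup>2) *
      ((y1 - inverse y1) / d * ((y2 * \<kappa>2 - inverse (y2 * \<kappa>2)) / d) *
        ((\<rho> * y1 - inverse (\<rho> * y1)) / d * ((h * y2 - inverse (h * y2)) / d) /
         ((h - inverse h) / d * ((h / r - inverse (h / r)) / d))))
      = r / (\<kappa>1 * \<kappa>2 * d\<^sup>2) * ((1 - a1) * (\<kappa>2\<^sup>2 - a2) * (b1 - \<kappa>1\<^sup>2) * (b1 - a1 * a2))"
  and "b1 \<noteq> a1 \<Longrightarrow> b1 * r\<^sup>2 \<noteq> a1 \<Longrightarrow>
      a2 * (b1 - a1) * (b1 * r\<^sup>2 - a1) *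
      ((y2 - inverse y2) / d * ((y1 * \<kappa>1 - inverse (y1 * \<kappa>1)) / d) *
       (((h / y1 - inverse (h / y1)) / d) / ((h - inverse h) / d)) *
       (((h * y2 * \<kappa>2 - inverse (h * y2 * \<kappa>2)) / d) / ((h * r - inverse (h * r)) / d)))
      = r / (\<kappa>1 * \<kappa>2 * d\<^sup>2) * ((1 - a2) * (\<kappa>1\<^sup>2 - a1) * (b1 - 1) * (b1 * \<kappa>2\<^sup>2 - a1 * a2))"
proof -
  have D: "b1 - a1 = (h - inverse h) * h / y1\<^sup>2"
    and E: "b1 - a1 * r\<^sup>2 = (h / r - inverse (h / r)) * h * r / y1\<^sup>2"
    and E': "b1 * r\<^sup>2 - a1 = (h * r - inverse (h * r)) * h * r / y1\<^sup>2"
    using assms by (simp_all add: field_simps power2_eq_square)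
  define u v w where uvw: "u = h - inverse h" "v = h / r - inverse (h / r)"
     "w = h * r - inverse (h * r)"
  {
    assume "b1 \<noteq> a1" "b1 \<noteq> a1 * r\<^sup>2"
    then have "u \<noteq> 0" "v \<noteq> 0" using D E by (auto simp: uvw)
    then show "a2 * (b1 - a1) * (b1 - a1 * r\<^sup>2) *
      ((y1 - inverse y1) / d * ((y2 * \<kappa>2 - inverse (y2 * \<kappa>2)) / d) *
        ((\<rho> * y1 - inverse (\<rho> * y1)) / d * ((h * y2 - inverse (h * y2)) / d) /
         ((h - inverse h) / d * ((h / r - inverse (h / r)) / d))))
      = r / (\<kappa>1 * \<kappa>2 * d\<^sup>2) * ((1 - a1) * (\<kappa>2\<^sup>2 - a2) * (b1 - \<kappa>1\<^sup>2) * (b1 - a1 * a2))"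
      unfolding D E unfolding uvw [symmetric] unfolding assms(8-11) using assms(1-7)
      by (simp add: divide_simps power2_eq_square) (simp add: algebra_simps)
  next
    assume "b1 \<noteq> a1" "b1 * r\<^sup>2 \<noteq> a1"
    then have "u \<noteq> 0" "w \<noteq> 0" using D E' by (auto simp: uvw)
    then show "a2 * (b1 - a1) * (b1 * r\<^sup>2 - a1) *
      ((y2 - inverse y2) / d * ((y1 * \<kappa>1 - inverse (y1 * \<kappa>1)) / d) *
       (((h / y1 - inverse (h / y1)) / d) / ((h - inverse h) / d)) *
       (((h * y2 * \<kappa>2 - inverse (h * y2 * \<kappa>2)) / d) / ((h * r - inverse (h * r)) / d)))
      = r / (\<kappa>1 * \<kappa>2 * d\<^sup>2) * ((1 - a2) * (\<kappa>1\<^sup>2 - a1) * (b1 - 1) * (b1 * \<kappa>2\<^sup>2 - a1 * a2))"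
      unfolding D E' unfolding uvw [symmetric] unfolding assms(8-11) using assms(1-7)
      by (simp add: divide_simps power2_eq_square) (simp add: algebra_simps)
  }
qed

lemma dynamic_rate_factor_first_empty:
  fixes r d y2 \<kappa>1 \<kappa>2 h :: real
  assumes "r > 0" "y2 > 0" "\<kappa>1 > 0" "\<kappa>2 > 0" "h > 0" "d \<noteq> 0"
    and "a2 = inverse (y2\<^sup>2)" "b1 = h\<^sup>2" and "b1 * r\<^sup>2 \<noteq> 1"
  shows "a2 * (b1 * r\<^sup>2 - 1) *
      ((y2 - inverse y2) / d * ((\<kappa>1 - inverse \<kappa>1) / d) *
       (((h * y2 * \<kappa>2 - inverse (h * y2 * \<kappa>2)) / d) / ((h * r - inverse (h * r)) / d)))
      = r / (\<kappa>1 * \<kappa>2 * d\<^sup>2) * ((1 - a2) * (\<kappa>1\<^sup>2 - 1) * (b1 * \<kappa>2\<^sup>2 - a2))"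
proof -
  have E: "b1 * r\<^sup>2 - 1 = (h * r - inverse (h * r)) * (h * r)"
    using assms by (simp add: field_simps power2_eq_square)
  define w where "w = h * r - inverse (h * r)"
  have "w \<noteq> 0" using E assms(9) by (auto simp: w_def)
  then show ?thesis
    unfolding E unfolding w_def [symmetric] unfolding assms(7,8) using assms(1-6)
    by (simp add: divide_simps power2_eq_square)
qed

section \<open>Duality for two sites with boundary height \<rho>\<close>

definition dyn_plus :: "real \<Rightarrow> real \<Rightarrow> real \<Rightarrow> real \<Rightarrow> nat \<Rightarrow> nat \<Rightarrow> real" where
  "dyn_plus q k1 k2 \<rho> x1 x2 =
     (let h = \<rho> + 2 * real x1 + k1 in
      if x1 = 0 then 0
      else qnum q (real x1) * qnum q (real x2 + k2) *
           ((qnum q (\<rho> + real x1) * qnum q (h + real x2)) / (qnum q h * qnum q (h - 1))))"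

text \<open>The departing site is the second one: its own height minus \<open>x2\<close> is
  \<open>h + x2 + k2\<close>.\<close>

definition dyn_minus :: "real \<Rightarrow> real \<Rightarrow> real \<Rightarrow> real \<Rightarrow> nat \<Rightarrow> nat \<Rightarrow> real" where
  "dyn_minus q k1 k2 \<rho> x1 x2 =
     (let h = \<rho> + 2 * real x1 + k1 in
      if x2 = 0 then 0
      else qnum q (real x2) * qnum q (real x1 + k1) *
           (if x1 = 0 then 1 else qnum q (h - real x1) / qnum q h) *
           (qnum q (h + real x2 + k2) / qnum q (h + 1)))"

text \<open>The power of \<open>Q\<close> is the part of the normalization of \<open>p_A\<close> at
  the second site that comes from the summand \<open>2 * x1\<close> of its boundary height.\<close>

definition two_site :: "real \<Rightarrow> real \<Rightarrow> real \<Rightarrow> real \<Rightarrow> nat \<Rightarrow> nat \<Rightarrow> nat \<Rightarrow> nat \<Rightarrow> real" where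
  "two_site Q k1 k2 \<rho> n1 n2 x1 x2 =
     Q powr (- (real n2 * real x1)) *
     asc Q (Q powr k1) n1 (Q powr - real x1) (Q powr (real x1 + \<rho> + k1)) *
     asc Q (Q powr k2) n2 (Q powr - real x2) (Q powr (real x2 + \<rho> + 2 * real x1 + k1 + k2))"

lemma powr_mult_power_neq_1:
  fixes Q :: real
  assumes "Q > 0" "Q \<noteq> 1" "k > 0"
  shows "Q powr k * Q ^ i \<noteq> 1"
proof -
  have "Q powr k * Q ^ i = Q powr (k + real i)"
    using assms by (simp add: powr_add powr_realpow)
  then show ?thesis
    using assms by (simp add: powr_eq_one_iff_gen)
qed

lemma two_site_shift_particle:
  assumes "Q > 0"
  shows "two_site Q k1 k2 \<rho> n1 (n2 + 1) x1 x2 =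
      Q powr (- (real n2 * real x1)) * (Q powr - real x1 *
     asc Q (Q powr k1) n1 (Q powr - real x1) (Q powr (real x1 + \<rho> + k1)) *
     asc Q (Q powr k2) (n2 + 1) (Q powr - real x2) (Q powr (real x2 + \<rho> + 2 * real x1 + k1 + k2)))"
    and "n2 \<ge> 1 \<Longrightarrow> two_site Q k1 k2 \<rho> n1 (n2 - 1) x1 x2 =
      Q powr (- (real n2 * real x1)) * (
     asc Q (Q powr k1) n1 (Q powr - real x1) (Q powr (real x1 + \<rho> + k1)) *
     asc Q (Q powr k2) (n2 - 1) (Q powr - real x2) (Q powr (real x2 + \<rho> + 2 * real x1 + k1 + k2))
      / Q powr - real x1)"
proof -
  have "Q powr (- (real (n2 + 1) * real x1)) = Q powr (- (real n2 * real x1)) * Q powr - real x1"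
    by (simp add: powr_add [symmetric] algebra_simps)
  then show "two_site Q k1 k2 \<rho> n1 (n2 + 1) x1 x2 =
      Q powr (- (real n2 * real x1)) * (Q powr - real x1 *
     asc Q (Q powr k1) n1 (Q powr - real x1) (Q powr (real x1 + \<rho> + k1)) *
     asc Q (Q powr k2) (n2 + 1) (Q powr - real x2) (Q powr (real x2 + \<rho> + 2 * real x1 + k1 + k2)))"
    by (simp add: two_site_def)
  assume "n2 \<ge> 1"
  then have "Q powr (- (real (n2 - 1) * real x1)) = Q powr (- (real n2 * real x1)) / Q powr - real x1"
    by (simp add: powr_diff [symmetric] of_nat_diff algebra_simps)
  then show "two_site Q k1 k2 \<rho> n1 (n2 - 1) x1 x2 =
      Q powr (- (real n2 * real x1)) * (
     asc Q (Q powr k1) n1 (Q powr - real x1) (Q powr (real x1 + \<rho> + k1)) *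
     asc Q (Q powr k2) (n2 - 1) (Q powr - real x2) (Q powr (real x2 + \<rho> + 2 * real x1 + k1 + k2))
      / Q powr - real x1)"
    by (simp add: two_site_def)
qed

text \<open>For the left hop the first series is written with its arguments interchanged, the form
  in which \<open>asc_exchange_raise\<close> applies.\<close>

lemma two_site_shift_dual:
  fixes Q k1 k2 \<rho> :: real and x1 x2 :: nat
  assumes "Q > 0"
  defines "a1 \<equiv> Q powr - real x1" and "b1 \<equiv> Q powr (real x1 + \<rho> + k1)"
    and "a2 \<equiv> Q powr - real x2" and "b2 \<equiv> Q powr (real x2 + \<rho> + 2 * real x1 + k1 + k2)"
  shows "x1 \<ge> 1 \<Longrightarrow> two_site Q k1 k2 \<rho> n1 n2 (x1 - 1) (x2 + 1) =
      Q powr (- (real n2 * real x1)) * (Q ^ n2 *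
     asc Q (Q powr k1) n1 (a1 * Q) (b1 / Q) * asc Q (Q powr k2) n2 (a2 / Q) (b2 / Q))"
    and "x2 \<ge> 1 \<Longrightarrow> two_site Q k1 k2 \<rho> n1 n2 (x1 + 1) (x2 - 1) =
      Q powr (- (real n2 * real x1)) * (
     asc Q (Q powr k1) n1 (b1 * Q) (a1 / Q) * asc Q (Q powr k2) n2 (a2 * Q) (b2 * Q) / Q ^ n2)"
proof -
  have Q: "Q = Q powr 1" "Q ^ n2 = Q powr real n2" using assms(1) by (simp_all add: powr_realpow)
  have mul: "Q powr z * Q = Q powr (z + 1)" and div: "Q powr z / Q = Q powr (z - 1)" for z
    using assms(1) by (simp_all add: powr_add powr_diff)
  {
    assume "x1 \<ge> 1"
    have "Q powr (- (real n2 * real (x1 - 1))) = Q powr (- (real n2 * real x1)) * Q ^ n2"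
      unfolding Q(2) using \<open>x1 \<ge> 1\<close> by (simp add: of_nat_diff powr_add [symmetric] algebra_simps)
    moreover have "Q powr - real (x1 - 1) = a1 * Q" "Q powr (real (x1 - 1) + \<rho> + k1) = b1 / Q"
        "Q powr - real (x2 + 1) = a2 / Q"
        "Q powr (real (x2 + 1) + \<rho> + 2 * real (x1 - 1) + k1 + k2) = b2 / Q"
      unfolding assms(2-5) mul div using \<open>x1 \<ge> 1\<close>
      by (auto simp: of_nat_diff intro!: arg_cong[where f = "(powr) Q"])
    ultimately show "two_site Q k1 k2 \<rho> n1 n2 (x1 - 1) (x2 + 1) =
      Q powr (- (real n2 * real x1)) * (Q ^ n2 *
     asc Q (Q powr k1) n1 (a1 * Q) (b1 / Q) * asc Q (Q powr k2) n2 (a2 / Q) (b2 / Q))"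
      unfolding two_site_def by (simp only: mult_ac)
  next
    assume "x2 \<ge> 1"
    have "Q powr (- (real n2 * real (x1 + 1))) = Q powr (- (real n2 * real x1)) / Q ^ n2"
      unfolding Q(2) powr_diff [symmetric]
      by (intro arg_cong[where f = "(powr) Q"]) (simp add: algebra_simps)
    moreover have "Q powr - real (x1 + 1) = a1 / Q" "Q powr (real (x1 + 1) + \<rho> + k1) = b1 * Q"
        "Q powr - real (x2 - 1) = a2 * Q"
        "Q powr (real (x2 - 1) + \<rho> + 2 * real (x1 + 1) + k1 + k2) = b2 * Q"
      unfolding assms(2-5) mul div using \<open>x2 \<ge> 1\<close>
      by (auto simp: of_nat_diff intro!: arg_cong[where f = "(powr) Q"])
    ultimately show "two_site Q k1 k2 \<rho> n1 n2 (x1 + 1) (x2 - 1) =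
      Q powr (- (real n2 * real x1)) * (
     asc Q (Q powr k1) n1 (b1 * Q) (a1 / Q) * asc Q (Q powr k2) n2 (a2 * Q) (b2 * Q) / Q ^ n2)"
      unfolding two_site_def asc_commute[of Q "Q powr k1" n1 "b1 * Q"]
      by (simp only: times_divide_eq_left times_divide_eq_right mult_ac)
  }
qed

lemma two_site_duality:
  fixes q k1 k2 \<rho> :: real and n1 n2 x1 x2 :: nat
  assumes q: "q > 0" "q \<noteq> 1" and k: "k1 > 0" "k2 > 0"
    and \<rho>: "\<rho> > - 1 \<or> \<rho> + 2 * real x1 + 2 * real x2 + k1 + k2 < 0"
  defines "Q \<equiv> (inverse q)\<^sup>2"
  defines "W \<equiv> two_site Q k1 k2 \<rho>"
  shows "q powr (real n1 + k1 - real n2 - 1) * qnum q (real n1) * qnum q (real n2 + k2) *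
           (W (n1 - 1) (n2 + 1) x1 x2 - W n1 n2 x1 x2)
       + q powr (- (real n2 + k2 - real n1 - 1)) * qnum q (real n2) * qnum q (real n1 + k1) *
           (W (n1 + 1) (n2 - 1) x1 x2 - W n1 n2 x1 x2)
       = dyn_plus q k1 k2 \<rho> x1 x2 * (W n1 n2 (x1 - 1) (x2 + 1) - W n1 n2 x1 x2)
       + dyn_minus q k1 k2 \<rho> x1 x2 * (W n1 n2 (x1 + 1) (x2 - 1) - W n1 n2 x1 x2)"
    (is "?cp * _ + ?cm * _ = ?Cp * _ + ?Cm * _")
proof -
  define r where "r = inverse q"
  define d where "d = inverse q - q"
  define m1 m2 where "m1 = r powr real n1" and "m2 = r powr real n2"
  define y1 y2 where "y1 = r powr real x1" and "y2 = r powr real x2"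
  define \<kappa>1 \<kappa>2 where "\<kappa>1 = r powr k1" and "\<kappa>2 = r powr k2"
  define \<sigma> where "\<sigma> = r powr \<rho>"
  define h where "h = \<sigma> * y1\<^sup>2 * \<kappa>1"
  have r: "r > 0" "r \<noteq> 1" using q by (auto simp: r_def)
  have pos: "m1 > 0" "m2 > 0" "y1 > 0" "y2 > 0" "\<kappa>1 > 0" "\<kappa>2 > 0" "\<sigma> > 0"
    using r by (simp_all add: m1_def m2_def y1_def y2_def \<kappa>1_def \<kappa>2_def \<sigma>_def)
  have "Q = r\<^sup>2" by (simp add: Q_def r_def)
  moreover from this have "Q > 0" "Q \<noteq> 1" using r by (auto simp: power2_eq_1_iff)
  ultimately have Q: "Q = r\<^sup>2" "Q > 0" "Q \<noteq> 1" by blast+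
  have Qpowr: "Q powr y = (r powr y)\<^sup>2" for y
    using r by (simp add: Q(1) power2_eq_square powr_mult)
  have "d \<noteq> 0"
    using q by (auto simp: d_def field_simps power2_eq_1_iff simp flip: power2_eq_square)
  have qnum: "qnum q y = (r powr y - inverse (r powr y)) / d" for y
    using qnum_eq[OF q(1)] by (simp add: r_def d_def)
  have qpow: "q powr y = inverse (r powr y)" for y
    using q by (simp add: r_def inverse_powr powr_minus)
  note expand = powr_add powr_diff
  define a1 a2 b1 b2 c1 c2 N1 N2 where "a1 = Q powr - real x1" and "a2 = Q powr - real x2"
    and "b1 = Q powr (real x1 + \<rho> + k1)"
    and "b2 = Q powr (real x2 + \<rho> + 2 * real x1 + k1 + k2)"
    and "c1 = Q powr k1" and "c2 = Q powr k2" and "N1 = Q ^ n1" and "N2 = Q ^ n2"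
  have c1: "c1 * Q ^ i \<noteq> 1" and c2: "c2 * Q ^ i \<noteq> 1" for i
    using powr_mult_power_neq_1[OF Q(2,3)] k by (simp_all add: c1_def c2_def)
  have a1: "a1 = inverse (y1\<^sup>2)" and a2: "a2 = inverse (y2\<^sup>2)"
    by (simp_all add: a1_def a2_def y1_def y2_def Qpowr powr_minus power_inverse)
  have b1: "b1 = y1\<^sup>2 * \<sigma>\<^sup>2 * \<kappa>1\<^sup>2"
    by (simp add: b1_def y1_def \<sigma>_def \<kappa>1_def Qpowr expand power_mult_distrib)
  have two: "r powr (2 * real x1) = y1\<^sup>2"
    unfolding y1_def mult_2 powr_add power2_eq_square ..
  have b2: "b2 = y2\<^sup>2 * \<sigma>\<^sup>2 * (y1\<^sup>2)\<^sup>2 * \<kappa>1\<^sup>2 * \<kappa>2\<^sup>2"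
    by (simp add: b2_def y2_def \<sigma>_def \<kappa>1_def \<kappa>2_def two Qpowr expand power_mult_distrib)
  have b12: "b1 * c2 = a1 * a2 * b2"
    using pos by (simp add: a1 a2 b1 b2 c2_def Qpowr \<kappa>2_def [symmetric] field_simps power2_eq_square)
  have N: "N1 = m1\<^sup>2" "N2 = m2\<^sup>2"
    unfolding N1_def N2_def m1_def m2_def Qpowr [symmetric] using Q by (simp_all add: powr_realpow)
  have c: "c1 = \<kappa>1\<^sup>2" "c2 = \<kappa>2\<^sup>2"
    unfolding c1_def c2_def \<kappa>1_def \<kappa>2_def Qpowr by (rule refl)+
  have nz: "a1 \<noteq> 0" "a2 \<noteq> 0" "c1 \<noteq> 0" "c2 \<noteq> 0" "N1 \<noteq> 0" "N2 \<noteq> 0" "Q \<noteq> 0"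
    using pos Q by (simp_all add: a1 a2 N c)
  define C where "C = r / (\<kappa>1 * \<kappa>2 * d\<^sup>2)"
  have C: "C \<noteq> 0" using pos r \<open>d \<noteq> 0\<close> by (simp add: C_def)
  define G where "G = Q powr (- (real n2 * real x1))"
  define f fm fp where "f = asc Q c1 n1 a1 b1" and "fm = asc Q c1 (n1 - 1) a1 b1"
    and "fp = asc Q c1 (Suc n1) a1 b1"
  define g gm gp where "g = asc Q c2 n2 a2 b2" and "gm = asc Q c2 (n2 - 1) a2 b2"
    and "gp = asc Q c2 (Suc n2) a2 b2"
  define fX fY where "fX = asc Q c1 n1 (a1 * Q) (b1 / Q)" and "fY = asc Q c1 n1 (b1 * Q) (a1 / Q)"
  define gX gY where "gX = asc Q c2 n2 (a2 / Q) (b2 / Q)" and "gY = asc Q c2 n2 (a2 * Q) (b2 * Q)"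
  have W0: "W n1 n2 x1 x2 = G * (f * g)"
    by (simp add: W_def two_site_def G_def f_def g_def a1_def a2_def b1_def b2_def c1_def c2_def)
  have Wp: "W (n1 - 1) (n2 + 1) x1 x2 = G * (a1 * fm * gp)"
    using two_site_shift_particle(1)[OF Q(2), of k1 k2 \<rho> "n1 - 1"]
    by (simp add: W_def G_def fm_def gp_def a1_def a2_def b1_def b2_def c1_def c2_def)
  have Wm: "n2 \<ge> 1 \<Longrightarrow> W (n1 + 1) (n2 - 1) x1 x2 = G * (fp * gm / a1)"
    using two_site_shift_particle(2)[OF Q(2), of n2 k1 k2 \<rho> "n1 + 1"]
    by (simp add: W_def G_def fp_def gm_def a1_def a2_def b1_def b2_def c1_def c2_def)
  have WX: "x1 \<ge> 1 \<Longrightarrow> W n1 n2 (x1 - 1) (x2 + 1) = G * (N2 * fX * gX)"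
    using two_site_shift_dual(1)[OF Q(2), of x1 k1 k2 \<rho> n1 n2 x2]
    by (simp add: W_def G_def fX_def gX_def a1_def a2_def b1_def b2_def c1_def c2_def N2_def)
  have WY: "x2 \<ge> 1 \<Longrightarrow> W n1 n2 (x1 + 1) (x2 - 1) = G * (fY * gY / N2)"
    using two_site_shift_dual(2)[OF Q(2), of x2 k1 k2 \<rho> n1 n2 x1]
    by (simp add: W_def G_def fY_def gY_def a1_def a2_def b1_def b2_def c1_def c2_def N2_def)
  have qn: "qnum q (real n1) = (m1 - inverse m1) / d" "qnum q (real n2) = (m2 - inverse m2) / d"
      "qnum q (real n1 + k1) = (m1 * \<kappa>1 - inverse (m1 * \<kappa>1)) / d"
      "qnum q (real n2 + k2) = (m2 * \<kappa>2 - inverse (m2 * \<kappa>2)) / d"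
    by (simp_all add: qnum powr_add m1_def m2_def \<kappa>1_def \<kappa>2_def)
  have "q powr (real n1 + k1 - real n2 - 1) = inverse (m1 * \<kappa>1 / (m2 * r))"
    unfolding qpow using r by (simp add: powr_add powr_diff m1_def m2_def \<kappa>1_def)
  then have cp: "?cp = C * ((1 - 1 / N1) * (c2 * N2 - 1))"
    using asip_rates_factor(1)[OF r(1) pos(1,2,5,6) \<open>d \<noteq> 0\<close>]
    by (simp only: qn C_def N c)
  have "q powr (- (real n2 + k2 - real n1 - 1)) = m2 * \<kappa>2 / (m1 * r)"
    unfolding qpow using r by (simp add: powr_add powr_diff powr_minus m1_def m2_def \<kappa>2_def)
  then have cm: "?cm = C * (c2 / Q * (N2 - 1) * (c1 - 1 / N1))"
    using asip_rates_factor(2)[OF r(1) pos(1,2,5,6) \<open>d \<noteq> 0\<close>]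
    by (simp only: qn C_def N c Q(1))
  have lhs: "?cp * (W (n1 - 1) (n2 + 1) x1 x2 - W n1 n2 x1 x2)
       + ?cm * (W (n1 + 1) (n2 - 1) x1 x2 - W n1 n2 x1 x2)
     = C * G * ((1 - 1 / N1) * (c2 * N2 - 1) * (a1 * fm * gp - f * g)
       + c2 / Q * (N2 - 1) * (c1 - 1 / N1) * (fp * gm / a1 - f * g))"
  proof (cases "n2 \<ge> 1")
    case True
    show ?thesis unfolding cp cm W0 Wp Wm[OF True] by (simp add: algebra_simps)
  next
    case False
    then have "n2 = 0" by simp
    then have "N2 = 1" by (simp add: N2_def)
    then show ?thesis unfolding cp cm W0 Wp by (simp add: algebra_simps)
  qed
  have rec_f: "(1 - c1 * N1) * fp = (a1 + b1 - (a1 * b1 + c1) * N1) * f + a1 * b1 * (N1 - 1) * fm"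
    unfolding fp_def f_def fm_def N1_def by (rule asc_recurrence[OF Q(2,3) c1])
  have rec_g: "(1 - c2 * N2) * gp = (a2 + b2 - (a2 * b2 + c2) * N2) * g + a2 * b2 * (N2 - 1) * gm"
    unfolding gp_def g_def gm_def N2_def by (rule asc_recurrence[OF Q(2,3) c2])
  have fX: "N1 * (b1 - c1) * (1 - a1) * fX = (b1 - a1 * Q) * ((1 - a1 * N1) * f + a1 * (N1 - 1) * fm)
       - N1 * (1 - a1) * (c1 - a1 * Q) * f"
    unfolding fX_def f_def fm_def N1_def by (rule asc_exchange_raise[OF Q(2,3) c1])
  have fY: "N1 * (a1 - c1) * (1 - b1) * fY = (a1 - b1 * Q) * ((1 - b1 * N1) * f + b1 * (N1 - 1) * fm)
       - N1 * (1 - b1) * (c1 - b1 * Q) * f"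
    unfolding fY_def f_def fm_def N1_def asc_commute[of Q c1 _ a1 b1]
    by (rule asc_exchange_raise[OF Q(2,3) c1])
  have gX: "Q * N2 * (a2 - c2) * (b2 - c2) * gX
       = (1 - c2 * N2) * (a2 * b2 - c2 * Q) * gp
         + a2 * b2 * (Q + c2 - a2 - b2 + (a2 * b2 - c2 * Q) * N2) * g"
    unfolding gX_def gp_def g_def N2_def by (rule asc_lower_both[OF Q(2,3) c2])
  have gY: "(1 - a2) * (1 - b2) * Q * gY
       = N2 * ((Q + c2 - (a2 + b2) * Q + (a2 * b2 * Q - c2) * N2) * g
         + (N2 - 1) * (c2 - a2 * b2 * Q) * gm)"
    unfolding gY_def gm_def g_def N2_def by (rule asc_raise_both[OF Q(2,3) c2])
  \<comment> \<open>The quotient of \<open>b1\<close> by \<open>a1\<close> is \<open>Q\<close> to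
    the middle height, so this excludes middle heights 0 and 1: the height exceeds 1 if
    \<open>\<rho> > - 1\<close>, since \<open>x1 \<ge> 1\<close>, and is negative otherwise.\<close>
  have D: "b1 \<noteq> a1" "b1 \<noteq> a1 * Q" if "x1 \<ge> 1"
  proof -
    have "\<rho> + 2 * real x1 + k1 \<noteq> 0" "\<rho> + 2 * real x1 + k1 \<noteq> 1"
      using \<rho> k that by linarith+
    moreover have "a1 * Q = Q powr (1 - real x1)"
      using Q(2,3) by (simp add: a1_def powr_diff powr_minus field_simps)
    ultimately show "b1 \<noteq> a1" "b1 \<noteq> a1 * Q"
      using Q(2,3) by (simp_all add: b1_def a1_def powr_inj)
  qed
  \<comment> \<open>Excludes middle height -1: the height is larger if \<open>\<rho> > - 1\<close>,
    and otherwise below -2 because of \<open>x2 \<ge> 1\<close>.\<close>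
  have D': "b1 * Q \<noteq> a1" if "x2 \<ge> 1"
  proof -
    have "\<rho> + 2 * real x1 + k1 \<noteq> - 1" using \<rho> k that by linarith
    moreover have "b1 * Q = Q powr (real x1 + \<rho> + k1 + 1)"
      using Q(2,3) by (simp add: b1_def powr_add)
    ultimately show ?thesis using Q(2,3) by (simp add: a1_def powr_inj)
  qed
  have h: "r powr (\<rho> + 2 * real x1 + k1) = h"
    by (simp add: h_def \<sigma>_def \<kappa>1_def two expand)
  define Cp Cm where "Cp = ?Cp / C" and "Cm = ?Cm / C"
  have Cp: "a2 * (b1 - a1) * (b1 - a1 * Q) * Cp
       = (1 - a1) * (c2 - a2) * (b1 - c1) * (b1 - a1 * a2)" if "x1 \<ge> 1"
  proof -
    have "?Cp = (y1 - inverse y1) / d * ((y2 * \<kappa>2 - inverse (y2 * \<kappa>2)) / d) *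
        ((\<sigma> * y1 - inverse (\<sigma> * y1)) / d * ((h * y2 - inverse (h * y2)) / d) /
         ((h - inverse h) / d * ((h / r - inverse (h / r)) / d)))"
      using that r
      by (simp add: dyn_plus_def Let_def qnum h powr_add[of r \<rho> "real x1"]
          powr_add[of r "real x2"] powr_add[of r _ "real x2"] powr_diff y1_def y2_def \<kappa>2_def \<sigma>_def)
    then have "a2 * (b1 - a1) * (b1 - a1 * Q) * ?Cp
       = C * ((1 - a1) * (c2 - a2) * (b1 - c1) * (b1 - a1 * a2))"
      using dynamic_rates_factor(1)[OF r(1) pos(3-7) \<open>d \<noteq> 0\<close> h_def a1 a2 b1] D[OF that]
      by (simp add: C_def c Q(1))
    then show ?thesis using C by (simp add: Cp_def field_simps)
  qed
  have Cm: "a2 * (b1 - a1) * (b1 * Q - a1) * Cm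
       = (1 - a2) * (c1 - a1) * (b1 - 1) * (b1 * c2 - a1 * a2)" if "x1 \<ge> 1" "x2 \<ge> 1"
  proof -
    have "?Cm = (y2 - inverse y2) / d * ((y1 * \<kappa>1 - inverse (y1 * \<kappa>1)) / d) *
       (((h / y1 - inverse (h / y1)) / d) / ((h - inverse h) / d)) *
       (((h * y2 * \<kappa>2 - inverse (h * y2 * \<kappa>2)) / d) / ((h * r - inverse (h * r)) / d))"
      using that r
      by (simp add: dyn_minus_def Let_def qnum h powr_add[of r _ 1] powr_add[of r "real x1" k1]
          powr_add[of r _ k2] powr_add[of r _ "real x2"] powr_diff y1_def y2_def \<kappa>1_def \<kappa>2_def)
    then have "a2 * (b1 - a1) * (b1 * Q - a1) * ?Cm
       = C * ((1 - a2) * (c1 - a1) * (b1 - 1) * (b1 * c2 - a1 * a2))"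
      using dynamic_rates_factor(2)[OF r(1) pos(3-7) \<open>d \<noteq> 0\<close> h_def a1 a2 b1] D[OF that(1)] D'[OF that(2)]
      by (simp add: C_def c Q(1))
    then show ?thesis using C by (simp add: Cm_def field_simps)
  qed
  have Cm0: "a2 * (b1 * Q - 1) * Cm = (1 - a2) * (c1 - 1) * (b1 * c2 - a2)" if "x1 = 0" "x2 \<ge> 1"
  proof -
    have y1: "y1 = 1" using that r by (simp add: y1_def)
    have "a1 = 1" using that Q by (simp add: a1_def)
    have b1h: "b1 = h\<^sup>2" by (simp add: b1 h_def y1 power_mult_distrib)
    have "?Cm = (y2 - inverse y2) / d * ((\<kappa>1 - inverse \<kappa>1) / d) *
       (((h * y2 * \<kappa>2 - inverse (h * y2 * \<kappa>2)) / d) / ((h * r - inverse (h * r)) / d))"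
      using that r h
      by (simp add: dyn_minus_def Let_def qnum powr_add[of r _ 1]
          powr_add[of r _ k2] powr_add[of r _ "real x2"] y2_def \<kappa>1_def \<kappa>2_def)
    moreover have "h > 0" using pos by (simp add: h_def)
    ultimately have "a2 * (b1 * Q - 1) * ?Cm = C * ((1 - a2) * (c1 - 1) * (b1 * c2 - a2))"
      using dynamic_rate_factor_first_empty[OF r(1) pos(4-6) _ \<open>d \<noteq> 0\<close> a2 b1h] D'[OF that(2)]
      by (simp add: C_def c Q(1) \<open>a1 = 1\<close>)
    then show ?thesis using C by (simp add: Cm_def field_simps)
  qed
  have dual: "(1 - 1 / N1) * (c2 * N2 - 1) * (a1 * fm * gp - f * g)
       + c2 / Q * (N2 - 1) * (c1 - 1 / N1) * (fp * gm / a1 - f * g)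
     = Cp * (N2 * fX * gX - f * g) + Cm * (fY * gY / N2 - f * g)"
  proof -
    have Cp0: "Cp = 0" if "x1 = 0" using that by (simp add: Cp_def dyn_plus_def)
    have Cm0': "Cm = 0" if "x2 = 0" using that by (simp add: Cm_def dyn_minus_def)
    have one1: "a1 = 1" "f = 1" "fm = 1" "fp = 1" if "x1 = 0"
      using that Q by (simp_all add: f_def fm_def fp_def a1_def)
    have one2: "a2 = 1" "g = 1" "gm = 1" "gp = 1" if "x2 = 0"
      using that Q by (simp_all add: g_def gm_def gp_def a2_def)
    consider "x1 = 0" "x2 = 0" | "x1 = 0" "x2 \<ge> 1" | "x1 \<ge> 1" "x2 = 0" | "x1 \<ge> 1" "x2 \<ge> 1"
      by linarith
    then show ?thesis
    proof cases
      case 1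
      then show ?thesis by (simp add: Cp0 Cm0' one1 one2)
    next
      case 2
      have "c1 \<noteq> 1" using c1[of 0] by simp
      \<comment> \<open>\<open>asc_exchange\<close> is used directly because
        \<open>asc_exchange_raise\<close> would carry the factor \<open>1 - b1\<close>, which can
        vanish here. Both series on the right have an argument 1 and hence equal 1.\<close>
      have "N1 * (1 - c1) * fY = (1 - b1 * Q) - N1 * (c1 - b1 * Q)"
        using asc_exchange[OF Q(2,3) c1, of n1 1 b1]
        by (simp add: fY_def N1_def one1(1)[OF 2(1)] asc_commute[of Q c1 n1 _ 1])
      then show ?thesis
        using two_site_first_empty[OF nz(2,5,6,7) _ \<open>c1 \<noteq> 1\<close> _ rec_g _ gY Cm0[OF 2], of fY]
          D'[OF 2(2)] b12
        by (simp add: Cp0 one1 2(1))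
    next
      case 3
      note one2 = one2[OF 3(2)]
      have b: "b1 * c2 = a1 * b2" using b12 by (simp add: one2)
      have g: "Q * N2 * (1 - c2) * (b2 - c2) * gX
          = (1 - c2 * N2) * (b2 - c2 * Q) + b2 * (Q + c2 - 1 - b2 + (b2 - c2 * Q) * N2)"
        using gX by (simp add: one2)
      have C: "(b1 - a1) * (b1 - a1 * Q) * Cp = (1 - a1) * (c2 - 1) * (b1 - c1) * (b1 - a1)"
        using Cp[OF 3(1)] by (simp add: one2)
      show ?thesis
        using two_site_second_empty[OF nz(1,4,5,6,7) D[OF 3(1)] b rec_f fX g C]
        by (simp add: Cm0'[OF 3(2)] one2)
    next
      case 4
      show ?thesis
        by (rule two_site_generic[OF nz D[OF 4(1)] D'[OF 4(2)] b12 rec_f rec_g fX fY gX gY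
              Cp[OF 4(1)] Cm[OF 4]])
    qed
  qed
  have "?Cp * (W n1 n2 (x1 - 1) (x2 + 1) - W n1 n2 x1 x2)
       + ?Cm * (W n1 n2 (x1 + 1) (x2 - 1) - W n1 n2 x1 x2)
     = C * G * (Cp * (N2 * fX * gX - f * g) + Cm * (fY * gY / N2 - f * g))"
  proof -
    have Cp_eq: "?Cp = C * Cp" and Cm_eq: "?Cm = C * Cm"
      using C by (simp_all add: Cp_def Cm_def)
    have "?Cp * (W n1 n2 (x1 - 1) (x2 + 1) - W n1 n2 x1 x2) = C * G * (Cp * (N2 * fX * gX - f * g))"
    proof (cases "x1 \<ge> 1")
      case True
      show ?thesis unfolding Cp_eq W0 WX[OF True] by (simp add: algebra_simps)
    qed (simp add: Cp_def dyn_plus_def)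
    moreover have "?Cm * (W n1 n2 (x1 + 1) (x2 - 1) - W n1 n2 x1 x2) = C * G * (Cm * (fY * gY / N2 - f * g))"
    proof (cases "x2 \<ge> 1")
      case True
      show ?thesis unfolding Cm_eq W0 WY[OF True] by (simp add: algebra_simps)
    qed (simp add: Cm_def dyn_minus_def)
    ultimately show ?thesis by (simp add: distrib_left)
  qed
  then show ?thesis unfolding lhs dual by simp
qed

section \<open>The polynomials \<open>p_A\<close> in base \<open>Q\<close>\<close>

lemma square_powr:
  fixes r :: real
  assumes "r > 0"
  shows "r\<^sup>2 powr y = r powr (2 * y)"
proof -
  have "r\<^sup>2 powr y = r powr y * r powr y"
    using assms by (simp add: power2_eq_square powr_mult)
  then show ?thesis
    unfolding mult_2 powr_add .
qed

lemma p_A_eq_asc: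
  assumes "r > 0"
  shows "p_A n x \<rho> k r = r powr (- (1/2) * real n * (2 * \<rho> + k + 1)) *
     asc (r\<^sup>2) (r\<^sup>2 powr k) n (r\<^sup>2 powr - real x) (r\<^sup>2 powr (real x + \<rho> + k))"
proof -
  have pw: "r powr (2 * y) = r\<^sup>2 powr y" for y
    using square_powr[OF assms] by simp
  have e: "- 2 * real n = 2 * - real n" "- 2 * real x = 2 * - real x"
     "2 * real x + 2 * \<rho> + 2 * k = 2 * (real x + \<rho> + k)"
    by simp_all
  have "r\<^sup>2 powr - real n = inverse ((r\<^sup>2) ^ n)"
    using assms by (subst powr_minus) (simp add: powr_realpow del: power2_eq_square)
  then show ?thesis
    unfolding p_A_def e pw using assms by (simp add: qhyp_3_2_eq_asc)
qed

section \<open>Reduction to a single bond\<close>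

lemma height_upd:
  assumes "1 \<le> j" and "x1 + x2 = \<zeta> j + \<zeta> (Suc j)" and "i \<noteq> j"
  shows "height k lam (\<zeta>(j := x1, Suc j := x2)) i = height k lam \<zeta> i"
proof (cases "i < j")
  case True
  then show ?thesis by (auto simp: height_def intro!: sum.cong)
next
  case False
  then have i: "Suc j \<le> i" using assms by simp
  have split: "{1..i} = insert j (insert (Suc j) ({1..i} - {j, Suc j}))"
    using i assms(1) by auto
  have *: "(\<Sum>l=1..i. 2 * real (\<xi> l) + k l)
     = 2 * real (\<xi> j) + k j + (2 * real (\<xi> (Suc j)) + k (Suc j))
       + (\<Sum>l\<in>{1..i} - {j, Suc j}. 2 * real (\<xi> l) + k l)" for \<xi>
    by (subst split) simp
  have "(\<Sum>l\<in>{1..i} - {j, Suc j}. 2 * real ((\<zeta>(j := x1, Suc j := x2)) l) + k l)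
      = (\<Sum>l\<in>{1..i} - {j, Suc j}. 2 * real (\<zeta> l) + k l)"
    by (rule sum.cong) auto
  moreover have "real x1 + real x2 = real (\<zeta> j) + real (\<zeta> (Suc j))"
    using assms(2) by (metis of_nat_add)
  ultimately show ?thesis unfolding height_def * by simp
qed

lemma height_Suc: "height k lam \<zeta> (Suc j) = height k lam \<zeta> j + 2 * real (\<zeta> (Suc j)) + k (Suc j)"
  by (simp add: height_def)

lemma height_upd_mid:
  assumes "1 \<le> j"
  shows "height k lam (\<zeta>(j := x1, Suc j := x2)) j = height k lam \<zeta> (j - 1) + 2 * real x1 + k j"
proof -
  obtain i where j: "j = Suc i" using assms by (cases j) auto
  have "height k lam (\<zeta>(j := x1, Suc j := x2)) i = height k lam \<zeta> i"
    by (auto simp: height_def j intro!: sum.cong)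
  then show ?thesis by (simp add: j height_Suc)
qed

text \<open>The part of the weight \<open>u\<close> coming from the two sites depends only on \<open>n1 + n2\<close> once the
  power \<open>Q powr (- n2 x1)\<close> of \<open>two_site\<close> is split off.\<close>
lemma P_L_bond:
  fixes q lam :: real and k :: "nat \<Rightarrow> real" and \<eta> \<zeta> :: state
  assumes "q > 0" and j: "1 \<le> j" "j < M"
  obtains B where "\<And>n1 n2 x1 x2. n1 + n2 = \<eta> j + \<eta> (Suc j) \<Longrightarrow> x1 + x2 = \<zeta> j + \<zeta> (Suc j) \<Longrightarrow>
    P_L M q k lam (\<eta>(j := n1, Suc j := n2)) (\<zeta>(j := x1, Suc j := x2))
     = B * two_site ((inverse q)\<^sup>2) (k j) (k (Suc j)) (height k lam \<zeta> (j - 1)) n1 n2 x1 x2"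
proof -
  define r where "r = inverse q"
  have r: "r > 0" using assms(1) by (simp add: r_def)
  define I where "I = {1..M} - {j, Suc j}"
  have split: "{1..M} = insert j (insert (Suc j) I)" "finite I" "j \<notin> insert (Suc j) I" "Suc j \<notin> I"
    using j by (auto simp: I_def)
  define \<kappa> where "\<kappa> = (\<Sum>i=1..<j. k i)"
  define \<rho> where "\<rho> = height k lam \<zeta> (j - 1)"
  define s where "s = real (\<eta> j + \<eta> (Suc j))"
  define u where "u = (\<Sum>i\<in>I. real (\<eta> i) * (k i + 2 * (\<Sum>l=1..<i. k l)))"
  define R where "R = (\<Prod>i\<in>I. p_A (\<eta> i) (\<zeta> i) (height k lam \<zeta> (i - 1)) (k i) r)"
  have k_Suc: "(\<Sum>i=1..<Suc j. k i) = \<kappa> + k j"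
    using j(1) by (simp add: \<kappa>_def)
  show thesis
  proof (rule that)
    fix n1 n2 x1 x2
    assume n: "n1 + n2 = \<eta> j + \<eta> (Suc j)" and x: "x1 + x2 = \<zeta> j + \<zeta> (Suc j)"
    let ?\<eta> = "\<eta>(j := n1, Suc j := n2)" and ?\<zeta> = "\<zeta>(j := x1, Suc j := x2)"
    have s: "s = real n1 + real n2" using n by (simp add: s_def flip: of_nat_add)
    have "(\<Sum>i\<in>I. real (?\<eta> i) * (k i + 2 * (\<Sum>l=1..<i. k l))) = u"
      unfolding u_def by (rule sum.cong) (auto simp: I_def)
    then have weight: "u_weight M k ?\<eta> = u + real n1 * (k j + 2 * \<kappa>)
        + real n2 * (k (Suc j) + 2 * (\<kappa> + k j))"
      unfolding u_weight_def split(1) using split(2-4) j(1) by (simp add: k_Suc [simplified] \<kappa>_def)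
    have "(\<Prod>i\<in>I. p_A (?\<eta> i) (?\<zeta> i) (height k lam ?\<zeta> (i - 1)) (k i) r) = R"
      unfolding R_def
    proof (rule prod.cong)
      fix i assume i: "i \<in> I"
      \<comment> \<open>The one height that depends on how the dual particles are split over the
        bond is that at \<open>j\<close>, and only the factor of site \<open>Suc j\<close> uses
        it.\<close>
      then have "i - 1 \<noteq> j" by (auto simp: I_def)
      then have "height k lam ?\<zeta> (i - 1) = height k lam \<zeta> (i - 1)"
        using height_upd[OF j(1) x] by blast
      then show "p_A (?\<eta> i) (?\<zeta> i) (height k lam ?\<zeta> (i - 1)) (k i) r
          = p_A (\<eta> i) (\<zeta> i) (height k lam \<zeta> (i - 1)) (k i) r"
        using i by (simp add: I_def)
    qed simp
    moreover have "height k lam ?\<zeta> (j - 1) = \<rho>"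
      unfolding \<rho>_def by (rule height_upd[OF j(1) x]) (use j in simp)
    moreover have "height k lam ?\<zeta> j = \<rho> + 2 * real x1 + k j"
      using height_upd_mid[OF j(1)] by (simp add: \<rho>_def)
    ultimately have prod: "(\<Prod>i=1..M. p_A (?\<eta> i) (?\<zeta> i) (height k lam ?\<zeta> (i - 1)) (k i) r)
        = p_A n1 x1 \<rho> (k j) r * (p_A n2 x2 (\<rho> + 2 * real x1 + k j) (k (Suc j)) r * R)"
      unfolding split(1) using split(2-4) by simp
    have q: "q powr y = r powr - y" for y
      using assms(1) by (simp add: r_def inverse_powr powr_minus)
    have arg: "real x2 + (\<rho> + 2 * real x1 + k j) + k (Suc j)
        = real x2 + \<rho> + 2 * real x1 + k j + k (Suc j)" by simp
    \<comment> \<open>The \<kappa> and \<open>k\<close> terms of the weight and of the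
      normalizations combine so that \<open>n1\<close> and \<open>n2\<close> enter only through
      their sum \<open>s\<close>, apart from \<open>n2 * x1\<close>. The double minus is the passage
      from \<open>q\<close> to \<open>r\<close>.\<close>
    have exponent: "r powr (- (- (1/2) * u_weight M k ?\<eta>)) * (r powr (- (1/2) * real n1 * (2 * \<rho> + k j + 1)) *
        r powr (- (1/2) * real n2 * (2 * (\<rho> + 2 * real x1 + k j) + k (Suc j) + 1)))
      = r powr (u / 2 + s * (\<kappa> - \<rho> - 1 / 2)) * r\<^sup>2 powr (- (real n2 * real x1))"
      unfolding square_powr[OF r] powr_add [symmetric] weight s
      by (intro arg_cong[where f = "(powr) r"]) (simp add: field_simps)
    have regroup: "A * (P1 * F1 * (P2 * F2 * R)) = R * K * (G * F1 * F2)"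
      if "A * (P1 * P2) = K * G" for A P1 P2 F1 F2 K G :: real
      using that by algebra
    show "P_L M q k lam ?\<eta> ?\<zeta> = (R * r powr (u / 2 + s * (\<kappa> - \<rho> - 1 / 2))) *
        two_site ((inverse q)\<^sup>2) (k j) (k (Suc j)) (height k lam \<zeta> (j - 1)) n1 n2 x1 x2"
      unfolding P_L_def q r_def [symmetric] prod
      unfolding p_A_eq_asc[OF r] two_site_def \<rho>_def [symmetric] arg
      by (rule regroup[OF exponent])
  qed
qed

lemma bond_duality:
  fixes q lam :: real and k :: "nat \<Rightarrow> real"
  assumes q: "q > 0" "q \<noteq> 1" and k: "\<And>j. j \<in> {1..M} \<Longrightarrow> k j > 0"
    and \<zeta>: "\<zeta> \<in> S_dyn M k lam" and j: "1 \<le> j" "j < M"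
  shows "c_plus q k j \<eta> * (P_L M q k lam (hop \<eta> j (j + 1)) \<zeta> - P_L M q k lam \<eta> \<zeta>)
       + c_minus q k (j + 1) \<eta> * (P_L M q k lam (hop \<eta> (j + 1) j) \<zeta> - P_L M q k lam \<eta> \<zeta>)
       = C_plus q k lam j \<zeta> * (P_L M q k lam \<eta> (hop \<zeta> j (j + 1)) - P_L M q k lam \<eta> \<zeta>)
       + C_minus q k lam (j + 1) \<zeta> * (P_L M q k lam \<eta> (hop \<zeta> (j + 1) j) - P_L M q k lam \<eta> \<zeta>)"
proof -
  define \<rho> where "\<rho> = height k lam \<zeta> (j - 1)"
  define W where "W = two_site ((inverse q)\<^sup>2) (k j) (k (Suc j)) \<rho>"
  obtain B where B: "\<And>n1 n2 x1 x2. n1 + n2 = \<eta> j + \<eta> (Suc j) \<Longrightarrow> x1 + x2 = \<zeta> j + \<zeta> (Suc j) \<Longrightarrow>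
    P_L M q k lam (\<eta>(j := n1, Suc j := n2)) (\<zeta>(j := x1, Suc j := x2)) = B * W n1 n2 x1 x2"
    using P_L_bond[OF q(1) j, of \<eta> \<zeta> k lam] unfolding W_def \<rho>_def by blast
  have site: "0 \<le> 2 * real (\<zeta> i) + k i" if "i \<in> {1..M}" for i
    using k[OF that] by simp
  have kj: "k j > 0" "k (Suc j) > 0" using k j by auto
  have hj: "height k lam \<zeta> j = \<rho> + 2 * real (\<zeta> j) + k j"
    using height_Suc[of k lam \<zeta> "j - 1"] j by (simp add: \<rho>_def)
  then have hSuc: "height k lam \<zeta> (Suc j)
      = \<rho> + 2 * real (\<zeta> j) + 2 * real (\<zeta> (Suc j)) + k j + k (Suc j)"
    by (simp add: height_Suc)
  \<comment> \<open>Heights increase along the sites since each summand is nonnegative. So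
    \<open>lam > - 1\<close> passes to the left end of the bond, and negativity of the total height
    passes to its right end.\<close>
  have \<rho>: "\<rho> > - 1 \<or> \<rho> + 2 * real (\<zeta> j) + 2 * real (\<zeta> (Suc j)) + k j + k (Suc j) < 0"
  proof (cases "lam > - 1")
    case True
    have "(\<Sum>i=1..j - 1. 2 * real (\<zeta> i) + k i) \<ge> 0"
      using site j by (intro sum_nonneg) auto
    then show ?thesis using True by (simp add: \<rho>_def height_def)
  next
    case False
    then have "2 * real (\<Sum>i=1..M. \<zeta> i) + (\<Sum>i=1..M. k i) + lam < 0"
      using \<zeta> by (simp add: S_dyn_def)
    then have "height k lam \<zeta> M < 0"
      by (simp add: height_def sum.distrib sum_distrib_left)
    moreover have "(\<Sum>i=1..Suc j. 2 * real (\<zeta> i) + k i) \<le> (\<Sum>i=1..M. 2 * real (\<zeta> i) + k i)"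
      using site j by (intro sum_mono2) auto
    ultimately have "height k lam \<zeta> (Suc j) < 0" by (simp only: height_def)
    then show ?thesis using hSuc by simp
  qed
  have self: "\<xi>(j := \<xi> j, Suc j := \<xi> (Suc j)) = \<xi>" for \<xi> :: state by simp
  have P0: "P_L M q k lam \<eta> \<zeta> = B * W (\<eta> j) (\<eta> (Suc j)) (\<zeta> j) (\<zeta> (Suc j))"
    using B[of "\<eta> j" "\<eta> (Suc j)" "\<zeta> j" "\<zeta> (Suc j)"] by simp
  have hop1: "hop \<xi> j (j + 1) = \<xi>(j := \<xi> j - 1, Suc j := \<xi> (Suc j) + 1)" if "\<xi> j \<ge> 1" for \<xi>
    using that by (simp add: hop_def)
  have hop2: "hop \<xi> (j + 1) j = \<xi>(j := \<xi> j + 1, Suc j := \<xi> (Suc j) - 1)" if "\<xi> (Suc j) \<ge> 1" for \<xi>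
    using that by (auto simp: hop_def fun_eq_iff)
  \<comment> \<open>Unlike the dynamic rates, the ASIP rates contain no case distinction; this is
    what makes them vanish at an empty site.\<close>
  have q0: "qnum q 0 = 0" by (simp add: qnum_def)
  have 1: "c_plus q k j \<eta> * (P_L M q k lam (hop \<eta> j (j + 1)) \<zeta> - P_L M q k lam \<eta> \<zeta>)
     = B * (q powr (real (\<eta> j) + k j - real (\<eta> (Suc j)) - 1) * qnum q (real (\<eta> j)) *
         qnum q (real (\<eta> (Suc j)) + k (Suc j)) *
         (W (\<eta> j - 1) (\<eta> (Suc j) + 1) (\<zeta> j) (\<zeta> (Suc j)) - W (\<eta> j) (\<eta> (Suc j)) (\<zeta> j) (\<zeta> (Suc j))))"
  proof (cases "\<eta> j \<ge> 1")
    case True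
    show ?thesis
      using B[of "\<eta> j - 1" "\<eta> (Suc j) + 1" "\<zeta> j" "\<zeta> (Suc j)"] True
      unfolding hop1[of \<eta>, OF True] P0 by (simp add: c_plus_def algebra_simps)
  next
    case False
    then have "\<eta> j = 0" by simp
    then show ?thesis by (simp add: c_plus_def q0)
  qed
  have 2: "c_minus q k (j + 1) \<eta> * (P_L M q k lam (hop \<eta> (j + 1) j) \<zeta> - P_L M q k lam \<eta> \<zeta>)
     = B * (q powr (- (real (\<eta> (Suc j)) + k (Suc j) - real (\<eta> j) - 1)) * qnum q (real (\<eta> (Suc j))) *
         qnum q (real (\<eta> j) + k j) *
         (W (\<eta> j + 1) (\<eta> (Suc j) - 1) (\<zeta> j) (\<zeta> (Suc j)) - W (\<eta> j) (\<eta> (Suc j)) (\<zeta> j) (\<zeta> (Suc j))))"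
  proof (cases "\<eta> (Suc j) \<ge> 1")
    case True
    show ?thesis
      using B[of "\<eta> j + 1" "\<eta> (Suc j) - 1" "\<zeta> j" "\<zeta> (Suc j)"] True
      unfolding hop2[of \<eta>, OF True] P0 by (simp add: c_minus_def algebra_simps)
  next
    case False
    then have "\<eta> (Suc j) = 0" by simp
    then show ?thesis by (simp add: c_minus_def q0)
  qed
  have Cp: "C_plus q k lam j \<zeta> = dyn_plus q (k j) (k (Suc j)) \<rho> (\<zeta> j) (\<zeta> (Suc j))"
    unfolding C_plus_def dyn_plus_def Let_def hj \<rho>_def [symmetric] by simp
  have Cm: "C_minus q k lam (j + 1) \<zeta> = dyn_minus q (k j) (k (Suc j)) \<rho> (\<zeta> j) (\<zeta> (Suc j))"
    by (simp add: C_minus_def dyn_minus_def Let_def hj hSuc) (simp add: algebra_simps)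
  have 3: "C_plus q k lam j \<zeta> * (P_L M q k lam \<eta> (hop \<zeta> j (j + 1)) - P_L M q k lam \<eta> \<zeta>)
     = B * (dyn_plus q (k j) (k (Suc j)) \<rho> (\<zeta> j) (\<zeta> (Suc j)) *
         (W (\<eta> j) (\<eta> (Suc j)) (\<zeta> j - 1) (\<zeta> (Suc j) + 1) - W (\<eta> j) (\<eta> (Suc j)) (\<zeta> j) (\<zeta> (Suc j))))"
  proof (cases "\<zeta> j \<ge> 1")
    case True
    show ?thesis
      using B[of "\<eta> j" "\<eta> (Suc j)" "\<zeta> j - 1" "\<zeta> (Suc j) + 1"] True
      unfolding hop1[of \<zeta>, OF True] P0 Cp by (simp add: algebra_simps)
  next
    case False
    then have "\<zeta> j = 0" by simp
    then show ?thesis by (simp add: Cp dyn_plus_def)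
  qed
  have 4: "C_minus q k lam (j + 1) \<zeta> * (P_L M q k lam \<eta> (hop \<zeta> (j + 1) j) - P_L M q k lam \<eta> \<zeta>)
     = B * (dyn_minus q (k j) (k (Suc j)) \<rho> (\<zeta> j) (\<zeta> (Suc j)) *
         (W (\<eta> j) (\<eta> (Suc j)) (\<zeta> j + 1) (\<zeta> (Suc j) - 1) - W (\<eta> j) (\<eta> (Suc j)) (\<zeta> j) (\<zeta> (Suc j))))"
  proof (cases "\<zeta> (Suc j) \<ge> 1")
    case True
    show ?thesis
      using B[of "\<eta> j" "\<eta> (Suc j)" "\<zeta> j + 1" "\<zeta> (Suc j) - 1"] True
      unfolding hop2[of \<zeta>, OF True] P0 Cm by (simp add: algebra_simps)
  next
    case False
    then have "\<zeta> (Suc j) = 0" by simp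
    then show ?thesis unfolding Cm by (simp add: dyn_minus_def)
  qed
  show ?thesis
    unfolding 1 2 3 4 distrib_left [symmetric] W_def
    by (rule arg_cong[where f = "(*) B"]) (rule two_site_duality[OF q kj \<rho>])
qed

theorem corollary2p8:
  fixes q :: real and M :: nat and k :: "nat \<Rightarrow> real" and lam :: real
  assumes "q > 0" and "q \<noteq> 1"
    and "\<And>j. j \<in> {1..M} \<Longrightarrow> k j > 0"
  shows "duality_function (X_d M) (L_ASIP M q k) (S_dyn M k lam) (L_ASIP_L M q k lam)
           (P_L M q k lam)"
  unfolding duality_function_def L_ASIP_def L_ASIP_L_def
  using bond_duality[OF assms] by (auto intro!: sum.cong)

end
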